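(* Define, for every integer $r\geqslant 2$, $m(r)=2^{(r+2)/2}-2$ if $r$ is even and $m(r)=5\cdot 2^{(r-3)/2}-2$ if $r$ is odd. Suppose that for every integer $r$ with $2\leqslant r\leqslant 46$, every reduced graph of rank $r$ has at most $m(r)$ vertices. Then for every integer $r\geqslant 2$, every reduced graph of rank $r$ has at most $m(r)$ vertices.
   Context: All graphs are finite and simple. The rank of a graph is the rank over $\mathbb{R}$ of its adjacency matrix. A graph is reduced if it has no isolated vertices and no two distinct vertices with the same set of neighbors. *)

theory Defs
  imports
    "HOL-Analysis.Analysis"
    "HOL-Library.Function_Algebras"
    "Graph_Theory.Pair_Digraph"
begin

text \<open>
  Finite simple graphs are the symmetric loop-free digraphs of \<^locale>\<open>pair_graph\<close>: finite vertex set
  \<open>pverts G\<close>, adjacency relation \<open>parcs G\<close>.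
\<close>

definition neighbors :: "'a pair_pre_digraph \<Rightarrow> 'a \<Rightarrow> 'a set" where
  "neighbors G u = {v. (u, v) \<in> parcs G}"

definition reduced_graph :: "'a pair_pre_digraph \<Rightarrow> bool" where
  "reduced_graph G \<longleftrightarrow>
     (\<forall>u\<in>pverts G. neighbors G u \<noteq> {}) \<and>
     (\<forall>u\<in>pverts G. \<forall>v\<in>pverts G. u \<noteq> v \<longrightarrow> neighbors G u \<noteq> neighbors G v)"

definition adjacency_matrix :: "'a pair_pre_digraph \<Rightarrow> 'a \<Rightarrow> 'a \<Rightarrow> real" where
  "adjacency_matrix G u v = (if (u, v) \<in> parcs G then 1 else 0)"

interpretation fun_vs: vector_space "\<lambda>(c::real) (f :: 'a \<Rightarrow> real) x. c * f x"
  by unfold_locales (auto simp: fun_eq_iff algebra_simps)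

text \<open>
  The order of a graph varies inside the statements below, so matrices are indexed by sets instead of
  finite types. The rows of a \<open>V \<times> V\<close> matrix are extended by \<open>0\<close> outside \<open>V\<close>, and the rank is the
  dimension of their span, exactly as in the definition of \<^const>\<open>rank\<close>
  (see \<open>set_matrix_rank_UNIV\<close>).
\<close>

definition set_matrix_rank :: "'a set \<Rightarrow> ('a \<Rightarrow> 'a \<Rightarrow> real) \<Rightarrow> nat" where
  "set_matrix_rank V A = fun_vs.dim ((\<lambda>u v. if v \<in> V then A u v else 0) ` V)"

definition graph_rank :: "'a pair_pre_digraph \<Rightarrow> nat" where
  "graph_rank G = set_matrix_rank (pverts G) (adjacency_matrix G)"

text \<open>The bound \<open>m(r)\<close>, only meaningful for \<open>r \<ge> 2\<close>; there no subtraction truncates.\<close>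

definition max_order :: "nat \<Rightarrow> nat" where
  "max_order r =
     (if even r then 2 ^ ((r + 2) div 2) - 2 else 5 * 2 ^ ((r - 3) div 2) - 2)"

lemma set_matrix_rank_UNIV:
  fixes A :: "'n::finite \<Rightarrow> 'n \<Rightarrow> real"
  shows "set_matrix_rank UNIV A = rank (\<chi> i j. A i j)"
proof -
  interpret vec_pair: finite_dimensional_vector_space_pair_1
      "scaleR :: real \<Rightarrow> real ^ 'n \<Rightarrow> real ^ 'n" Basis
      "\<lambda>(c::real) (f :: 'n \<Rightarrow> real) x. c * f x"
    by unfold_locales
  have lin: "Vector_Spaces.linear scaleR (\<lambda>(c::real) (f :: 'n \<Rightarrow> real) x. c * f x) vec_nth"
    by unfold_locales (auto simp: fun_eq_iff)
  have rows_eq: "range A = vec_nth ` rows (\<chi> i j. A i j)"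
    by (force simp: rows_def row_def fun_eq_iff image_iff)
  have "fun_vs.dim (vec_nth ` rows (\<chi> i j. A i j)) = dim (rows (\<chi> i j. A i j))"
    by (rule vec_pair.dim_image_eq[OF lin, folded dim_raw_def span_raw_def])
      (metis inj_onI vec_nth_inject)
  then show ?thesis
    by (simp add: set_matrix_rank_def row_rank_def flip: rows_eq)
qed

end

theory Submission
  imports Defs
begin

text \<open>
  Let \<open>G\<close> be a counterexample of least rank \<open>r \<ge> 47\<close>, with \<open>n\<close> vertices, and let the distance of two
  vertices be the number of vertices adjacent to exactly one of them. Deleting the vertices on which
  some rows of the adjacency matrix differ makes these rows equal and so lowers the rank; by
  minimality only few pairwise different rows survive. Applied to a closest non-adjacent pair this
  shows that non-adjacent vertices have distance at least \<open>(1/2 - 1/256) n\<close>; applied to three vertices it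
  then shows that every triangle has perimeter at least \<open>(1 - 1/128) n\<close>, so the average distance in
  any set of at least three vertices is almost \<open>n/3\<close>. The rows with entries \<open>\<plusminus>1 / sqrt n\<close> are unit
  vectors in dimension \<open>r + 1\<close>, and the bound on the average distance puts at most 30 of them into
  any spherical cap \<open>{y. x \<bullet> y \<ge> 3/5}\<close>. Averaging over all caps bounds \<open>n\<close> by roughly \<open>(5/4) ^ r\<close>,
  which is less than \<open>m(r)\<close>, of order \<open>2 powr (r/2)\<close>, from \<open>r = 47\<close> on.
\<close>

section \<open>Ranks of principal submatrices\<close>

text \<open>Lowering the rank by two roughly halves \<open>m\<close>, so a set of more than n/2
  vertices whose rank dropped by two must contain twins. Two equal rows give this drop when both
  vertices survive the deletion, as non-adjacent ones do. Adjacent vertices lie in their own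
  difference set, and two agreeing rows outside the remaining set guarantee a drop of one only,
  which is too weak since \<open>m(r - 1)\<close> can be about \<open>4/5 m(r)\<close>. So adjacent
  pairs get no distance bound; three agreeing rows, being more than 2^1, again force a drop of two,
  which is why triangles are measured. The loss 1/256 balances two needs. A closest pair below the
  bound leaves more than n/256 twin pairs, and \<open>256 m(r - 16) + 510 = m(r)\<close> then keeps
  the rank on their union above r - 16, so the difference set has bounded size however large n is.
  On the other side, the mean inner product of many vectors is bounded by nearly 1 - 127/192 =
  65/192, still below 9/25 = (3/5)^2, as the cap estimate requires.\<close>

lemma fun_sum_apply: "(\<Sum>w\<in>S. (F w :: 'a \<Rightarrow> real)) v = (\<Sum>w\<in>S. F w v)"
  by (induction S rule: infinite_finite_induct) auto

lemma fun_dim_mono: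
  assumes "finite S'" "S \<subseteq> fun_vs.span S'"
  shows "fun_vs.dim S \<le> fun_vs.dim S'"
proof -
  obtain B where B: "B \<subseteq> S'" "fun_vs.independent B" "S' \<subseteq> fun_vs.span B" "card B = fun_vs.dim S'"
    by (rule fun_vs.basis_exists)
  have "fun_vs.span S' \<subseteq> fun_vs.span B"
    using B(3) by (simp add: fun_vs.span_minimal fun_vs.subspace_span)
  with assms(2) have "S \<subseteq> fun_vs.span B" by blast
  from fun_vs.dim_le_card[OF this finite_subset[OF B(1) assms(1)]] B(4) show ?thesis by simp
qed

lemma fun_dim_insert:
  assumes "finite S" "a \<notin> fun_vs.span S"
  shows "fun_vs.dim (insert a S) = Suc (fun_vs.dim S)"
proof -
  obtain B where B: "B \<subseteq> S" "fun_vs.independent B" "S \<subseteq> fun_vs.span B" "card B = fun_vs.dim S"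
    by (rule fun_vs.basis_exists)
  have finB: "finite B" using B(1) assms(1) by (rule finite_subset)
  have aB: "a \<notin> fun_vs.span B" using assms(2) fun_vs.span_mono[OF B(1)] by blast
  then have "a \<notin> B" using fun_vs.span_superset by blast
  have "fun_vs.independent (insert a B)" using B(2) aB by (simp add: fun_vs.independent_insert)
  moreover have "insert a B \<subseteq> insert a S" using B(1) by blast
  moreover have "insert a S \<subseteq> fun_vs.span (insert a B)"
    using B(3) fun_vs.span_mono[of B "insert a B"] fun_vs.span_base[of a "insert a B"] by blast
  ultimately have "card (insert a B) = fun_vs.dim (insert a S)"
    by (intro fun_vs.basis_card_eq_dim)
  with finB \<open>a \<notin> B\<close> B(4) show ?thesis by simp
qed

lemma fun_span_functional_zero:
  fixes z :: "'a \<Rightarrow> real"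
  assumes "f \<in> fun_vs.span S" "\<And>g. g \<in> S \<Longrightarrow> (\<Sum>w\<in>W. z w * g w) = 0"
  shows "(\<Sum>w\<in>W. z w * f w) = 0"
  using assms(1)
proof (induction rule: fun_vs.span_induct_alt)
  case base
  then show ?case by simp
next
  case (step c x y)
  have "(\<Sum>w\<in>W. z w * (c * x w + y w)) = c * (\<Sum>w\<in>W. z w * x w) + (\<Sum>w\<in>W. z w * y w)"
    by (simp add: sum_distrib_left sum.distrib algebra_simps)
  then show ?case using step assms(2) by simp
qed

definition row_on :: "('a \<Rightarrow> 'a \<Rightarrow> real) \<Rightarrow> 'a set \<Rightarrow> 'a \<Rightarrow> 'a \<Rightarrow> real" where
  "row_on A T u = (\<lambda>v. if v \<in> T then A u v else 0)"

lemma set_matrix_rank_row_on: "set_matrix_rank T A = fun_vs.dim (row_on A T ` T)"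
  by (simp add: set_matrix_rank_def row_on_def[abs_def])

lemma fun_span_pullback:
  fixes f :: "'a \<Rightarrow> real" and p :: "'b \<Rightarrow> 'a"
  assumes "f \<in> fun_vs.span S"
  shows "(\<lambda>t. if t \<in> T then f (p t) else 0) \<in> fun_vs.span ((\<lambda>g t. if t \<in> T then g (p t) else 0) ` S)"
  using assms
proof (induction rule: fun_vs.span_induct_alt)
  case base
  have "(\<lambda>t. if t \<in> T then (0 :: 'a \<Rightarrow> real) (p t) else 0) = 0" by auto
  then show ?case by (simp only: fun_vs.span_zero)
next
  case (step c x y)
  let ?R = "\<lambda>g t. if t \<in> T then g (p t) else (0 :: real)"
  have eq: "?R ((\<lambda>v. c * x v) + y) = (\<lambda>v. c * ?R x v) + ?R y" by (auto simp: fun_eq_iff)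
  have "?R x \<in> fun_vs.span (?R ` S)" using step(1) by (intro fun_vs.span_base) auto
  then have "(\<lambda>v. c * ?R x v) + ?R y \<in> fun_vs.span (?R ` S)"
    using step(2) by (intro fun_vs.span_add fun_vs.span_scale)
  then show ?case by (simp only: eq)
qed

lemma set_matrix_rank_reindex_le_rows:
  assumes "finite T" "p ` T \<subseteq> V"
  shows "set_matrix_rank T (\<lambda>s t. A (p s) (p t)) \<le> fun_vs.dim (row_on A V ` p ` T)"
proof -
  obtain B where B: "B \<subseteq> row_on A V ` p ` T" "fun_vs.independent B" "row_on A V ` p ` T \<subseteq> fun_vs.span B"
      "card B = fun_vs.dim (row_on A V ` p ` T)"
    by (rule fun_vs.basis_exists)
  have finB: "finite B" using B(1) assms(1) finite_subset by blast
  let ?R = "\<lambda>g t. if t \<in> T then g (p t) else (0 :: real)"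
  let ?A = "\<lambda>s t. A (p s) (p t)"
  have "row_on ?A T ` T \<subseteq> fun_vs.span (?R ` B)"
  proof (rule image_subsetI)
    fix t assume t: "t \<in> T"
    have "row_on ?A T t = ?R (row_on A V (p t))" using assms(2) by (auto simp: row_on_def fun_eq_iff)
    moreover have "row_on A V (p t) \<in> fun_vs.span B" using B(3) t by blast
    ultimately show "row_on ?A T t \<in> fun_vs.span (?R ` B)" using fun_span_pullback by simp
  qed
  then have "set_matrix_rank T ?A \<le> card (?R ` B)"
    unfolding set_matrix_rank_row_on using finB by (intro fun_vs.dim_le_card) auto
  also have "\<dots> \<le> card B" by (rule card_image_le[OF finB])
  finally show ?thesis using B(4) by simp
qed

lemma set_matrix_rank_le_rows:
  assumes "finite V" "T \<subseteq> V"
  shows "set_matrix_rank T A \<le> fun_vs.dim (row_on A V ` T)"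
  using set_matrix_rank_reindex_le_rows[of T "\<lambda>t. t" V A] assms by (simp add: finite_subset)

lemma set_matrix_rank_reindex_le:
  assumes "finite T" "finite V" "p ` T \<subseteq> V"
  shows "set_matrix_rank T (\<lambda>s t. A (p s) (p t)) \<le> set_matrix_rank V A"
proof -
  have "fun_vs.dim (row_on A V ` p ` T) \<le> fun_vs.dim (row_on A V ` V)"
    using assms by (intro fun_dim_mono) (auto intro!: fun_vs.span_base)
  then show ?thesis using set_matrix_rank_reindex_le_rows[OF assms(1,3), of A] by (simp add: set_matrix_rank_row_on)
qed

lemma set_matrix_rank_mono:
  assumes "finite V" "T \<subseteq> V"
  shows "set_matrix_rank T A \<le> set_matrix_rank V A"
  using set_matrix_rank_reindex_le[of T V "\<lambda>t. t" A] assms by (simp add: finite_subset)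

lemma set_matrix_rank_cong:
  assumes "\<And>u v. u \<in> T \<Longrightarrow> v \<in> T \<Longrightarrow> A u v = A' u v"
  shows "set_matrix_rank T A = set_matrix_rank T A'"
proof -
  have "row_on A T ` T = row_on A' T ` T"
    by (intro image_cong) (auto simp: row_on_def fun_eq_iff assms)
  then show ?thesis by (simp add: set_matrix_rank_row_on)
qed

text \<open>A basis of the full rows of \<open>T\<close> is extended to a basis of the row space;
  \<open>J\<close> indexes the added rows. By symmetry, a relation that vanishes on the columns of
  \<open>T\<close> and \<open>J\<close> kills a basis, hence every row. The full rows of
  \<open>T\<close> can have larger rank than the submatrix, hence only an inequality for
  \<open>card J\<close>.\<close>

lemma determining_columns:
  fixes A :: "'a \<Rightarrow> 'a \<Rightarrow> real"
  assumes "finite V" "T \<subseteq> V" and sym: "\<And>u v. A u v = A v u"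
  obtains J where "J \<subseteq> V" "card J + set_matrix_rank T A \<le> set_matrix_rank V A"
    "\<And>z. (\<And>t. t \<in> T \<union> J \<Longrightarrow> (\<Sum>w\<in>V. z w * A w t) = 0) \<Longrightarrow>
       (\<And>v. v \<in> V \<Longrightarrow> (\<Sum>w\<in>V. z w * A w v) = 0)"
proof -
  have finT: "finite T" using assms(1,2) by (rule rev_finite_subset)
  let ?R = "row_on A V"
  obtain B1 where B1: "B1 \<subseteq> ?R ` T" "fun_vs.independent B1" "?R ` T \<subseteq> fun_vs.span B1"
      "card B1 = fun_vs.dim (?R ` T)"
    by (rule fun_vs.basis_exists)
  have "B1 \<subseteq> ?R ` V" using B1(1) assms(2) by blast
  then obtain B where B: "B1 \<subseteq> B" "B \<subseteq> ?R ` V" "fun_vs.independent B" "?R ` V \<subseteq> fun_vs.span B"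
    using fun_vs.maximal_independent_subset_extend[OF _ B1(2)] by blast
  have finB: "finite B" using B(2) assms(1) finite_subset by blast
  have cB: "card B = set_matrix_rank V A"
    using fun_vs.basis_card_eq_dim[OF B(2,4,3)] by (simp add: set_matrix_rank_row_on)
  define J where "J = inv_into V ?R ` (B - B1)"
  have JV: "J \<subseteq> V" using B(2) by (auto simp: J_def intro!: inv_into_into)
  have RJ: "?R ` J = B - B1"
  proof -
    have "?R (inv_into V ?R g) = g" if "g \<in> B" for g
      using that B(2) by (intro f_inv_into_f) blast
    then have "(\<lambda>g. ?R (inv_into V ?R g)) ` (B - B1) = (\<lambda>g. g) ` (B - B1)"
      by (intro image_cong) auto
    then show ?thesis by (simp only: J_def image_image image_ident)
  qed
  have "card J \<le> card (B - B1)" unfolding J_def using finB by (intro card_image_le) auto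
  also have "\<dots> = card B - card B1" using finB B(1) by (intro card_Diff_subset) (auto intro: finite_subset)
  finally have "card J + card B1 \<le> card B" using card_mono[OF finB B(1)] by simp
  moreover have "set_matrix_rank T A \<le> card B1"
    using set_matrix_rank_le_rows[OF assms(1,2), of A] B1(4) by simp
  ultimately have card: "card J + set_matrix_rank T A \<le> set_matrix_rank V A" using cB by simp
  show thesis
  proof (rule that[OF JV card])
    fix z :: "'a \<Rightarrow> real" and v
    assume z: "\<And>t. t \<in> T \<union> J \<Longrightarrow> (\<Sum>w\<in>V. z w * A w t) = 0" and v: "v \<in> V"
    have "?R v \<in> fun_vs.span B" using B(4) v by blast
    then have "(\<Sum>w\<in>V. z w * ?R v w) = 0"
    proof (rule fun_span_functional_zero)
      fix g assume "g \<in> B"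
      then have "g \<in> ?R ` (T \<union> J)" using B1(1) RJ by blast
      then obtain t where t: "t \<in> T \<union> J" "g = ?R t" by blast
      then show "(\<Sum>w\<in>V. z w * g w) = 0" using z[OF t(1)] by (simp add: row_on_def sym cong: sum.cong)
    qed
    then show "(\<Sum>w\<in>V. z w * A w v) = 0" by (simp add: row_on_def sym cong: sum.cong)
  qed
qed

text \<open>Combined with the coefficients \<open>z\<close>, the rows of \<open>T\<close> prolonged
  by column \<open>y\<close> yield a multiple of the unit vector at \<open>y\<close>, so prolonging
  them gains one dimension. The relation \<open>z\<close> annihilates all prolonged rows but not the
  row of \<open>y\<close>, which gains a second one.\<close>

lemma set_matrix_rank_insert_ge:
  fixes A :: "'a \<Rightarrow> 'a \<Rightarrow> real"
  assumes fin: "finite T" and y: "y \<notin> T" and sym: "\<And>u v. A u v = A v u"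
    and z: "\<And>t. t \<in> T \<Longrightarrow> (\<Sum>w\<in>T. z w * A w t) = 0" and zy: "(\<Sum>w\<in>T. z w * A w y) \<noteq> 0"
  shows "set_matrix_rank T A + 2 \<le> set_matrix_rank (insert y T) A"
proof -
  let ?T = "insert y T"
  let ?P = "row_on A T ` T" and ?S = "row_on A ?T ` T"
  define e :: "'a \<Rightarrow> real" where "e = (\<lambda>v. if v = y then 1 else 0)"
  define \<beta> where "\<beta> = (\<Sum>w\<in>T. z w * A w y)"
  have "(\<Sum>w\<in>T. (\<lambda>v. z w * row_on A ?T w v)) \<in> fun_vs.span ?S"
    by (intro fun_vs.span_sum fun_vs.span_scale fun_vs.span_base) auto
  moreover have "(\<Sum>w\<in>T. (\<lambda>v. z w * row_on A ?T w v)) = (\<lambda>v. \<beta> * e v)"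
  proof
    fix v
    have "(\<Sum>w\<in>T. (\<lambda>v. z w * row_on A ?T w v)) v = (\<Sum>w\<in>T. z w * row_on A ?T w v)"
      by (rule fun_sum_apply)
    also have "\<dots> = \<beta> * e v"
      using z[of v] y by (cases "v = y"; cases "v \<in> T") (auto simp: row_on_def e_def \<beta>_def)
    finally show "(\<Sum>w\<in>T. (\<lambda>v. z w * row_on A ?T w v)) v = \<beta> * e v" .
  qed
  ultimately have "(\<lambda>v. \<beta> * e v) \<in> fun_vs.span ?S" by simp
  then have "(\<lambda>v. (1 / \<beta>) * (\<beta> * e v)) \<in> fun_vs.span ?S" by (rule fun_vs.span_scale)
  then have eS: "e \<in> fun_vs.span ?S" using zy by (simp add: \<beta>_def)
  have sub: "?P \<subseteq> fun_vs.span ?S"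
  proof (rule subsetI)
    fix f assume "f \<in> ?P"
    then obtain t where t: "t \<in> T" "f = row_on A T t" by (elim imageE)
    have "f = row_on A ?T t - (\<lambda>v. A t y * e v)"
      unfolding t(2) row_on_def e_def fun_eq_iff using y by simp
    also have "\<dots> \<in> fun_vs.span ?S"
      using fun_vs.span_diff[OF fun_vs.span_base[OF imageI[OF t(1)]] fun_vs.span_scale[OF eS]] .
    finally show "f \<in> fun_vs.span ?S" .
  qed
  have "e \<notin> fun_vs.span ?P"
  proof
    assume "e \<in> fun_vs.span ?P"
    then have "(\<Sum>w\<in>{y}. 1 * e w) = 0"
      by (rule fun_span_functional_zero) (use y in \<open>auto simp: row_on_def\<close>)
    then show False by (simp add: e_def)
  qed
  then have "Suc (fun_vs.dim ?P) = fun_vs.dim (insert e ?P)"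
    using fin by (simp add: fun_dim_insert)
  also have "\<dots> \<le> fun_vs.dim ?S" using fin eS sub by (intro fun_dim_mono) auto
  finally have 1: "Suc (fun_vs.dim ?P) \<le> fun_vs.dim ?S" .
  have "row_on A ?T y \<notin> fun_vs.span ?S"
  proof
    assume "row_on A ?T y \<in> fun_vs.span ?S"
    then have "(\<Sum>w\<in>T. z w * row_on A ?T y w) = 0"
    proof (rule fun_span_functional_zero)
      fix g assume "g \<in> ?S"
      then obtain t where "t \<in> T" "g = row_on A ?T t" by (elim imageE)
      then show "(\<Sum>w\<in>T. z w * g w) = 0" using z[of t] by (simp add: row_on_def sym cong: sum.cong)
    qed
    then show False using zy by (simp add: row_on_def sym cong: sum.cong)
  qed
  then have "fun_vs.dim (insert (row_on A ?T y) ?S) = Suc (fun_vs.dim ?S)"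
    using fin by (simp add: fun_dim_insert)
  with 1 show ?thesis by (simp add: set_matrix_rank_row_on)
qed

text \<open>Gram-Schmidt, stated as a Parseval identity. The form summing over \<open>V\<close> is
  only semidefinite, since functions may differ outside \<open>V\<close>, and \<open>B\<close> may
  be dependent; only the identity is kept, not orthonormality.\<close>

lemma orthonormal_coordinates:
  fixes V :: "'a set"
  assumes "finite V" "finite B"
  shows "\<exists>e :: nat \<Rightarrow> 'a \<Rightarrow> real. (\<forall>k<card B. e k \<in> fun_vs.span B) \<and>
     (\<forall>f\<in>fun_vs.span B. \<forall>g. (\<Sum>v\<in>V. f v * g v) = (\<Sum>k<card B. (\<Sum>v\<in>V. f v * e k v) * (\<Sum>v\<in>V. e k v * g v)))"
  using assms(2)
proof (induction B rule: finite_induct)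
  case empty
  then show ?case by auto
next
  case (insert b B)
  define ip :: "('a \<Rightarrow> real) \<Rightarrow> ('a \<Rightarrow> real) \<Rightarrow> real" where "ip f g = (\<Sum>v\<in>V. f v * g v)" for f g
  have ip_add: "ip (f + f') g = ip f g + ip f' g" "ip f (g + g') = ip f g + ip f g'" 
    and ip_diff: "ip (f - f') g = ip f g - ip f' g" "ip f (g - g') = ip f g - ip f g'"
    and ip_scale: "ip (\<lambda>v. c * f v) g = c * ip f g" "ip f (\<lambda>v. c * g v) = c * ip f g"
    and ip_sym: "ip f g = ip g f" for f f' g g' c
    by (simp_all add: ip_def algebra_simps sum.distrib sum_subtractf sum_distrib_left)
  have ip_sum: "ip (\<Sum>k<m. h k) g = (\<Sum>k<m. ip (h k) g)" "ip g (\<Sum>k<m. h k) = (\<Sum>k<m. ip g (h k))"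
    for h :: "nat \<Rightarrow> 'a \<Rightarrow> real" and m g
    by (induction m) (auto simp: ip_add, simp_all add: ip_def)
  obtain e :: "nat \<Rightarrow> 'a \<Rightarrow> real" where e: "\<And>k. k < card B \<Longrightarrow> e k \<in> fun_vs.span B"
    "\<And>f g. f \<in> fun_vs.span B \<Longrightarrow> ip f g = (\<Sum>k<card B. ip f (e k) * ip (e k) g)"
    using insert.IH unfolding ip_def by blast
  define b' where "b' = b - (\<Sum>k<card B. (\<lambda>v. ip b (e k) * e k v))"
  have bb': "ip b' g = ip b g - (\<Sum>k<card B. ip b (e k) * ip (e k) g)" for g
    by (simp add: b'_def ip_diff ip_sum ip_scale)
  have orth: "ip h b' = 0" if "h \<in> fun_vs.span B" for h
    using e(2)[OF that, of b] by (subst ip_sym) (simp add: bb' ip_sym[of b] ip_sym[of "e _" h] mult.commute)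
  define N where "N = ip b' b'"
  \<comment> \<open>A residual of norm zero vanishes on \<open>V\<close> and contributes nothing, so
    the new coordinate vector may be zero.\<close>
  define c where "c = (if N = 0 then 0 else 1 / sqrt N)"
  define e' where "e' = e(card B := (\<lambda>v. c * b' v))"
  have N0: "N \<ge> 0" by (auto simp: N_def ip_def intro!: sum_nonneg)
  have bN: "ip b b' = N"
    using orth[OF e(1)] by (simp add: N_def bb')
  have key: "ip b' g = ip b (\<lambda>v. c * b' v) * ip (\<lambda>v. c * b' v) g" for g
  proof (cases "N = 0")
    case True
    then have "b' v = 0" if "v \<in> V" for v
      using that assms(1) unfolding N_def ip_def by (subst (asm) sum_nonneg_eq_0_iff) auto
    then have "ip b' g = 0" by (simp add: ip_def)
    then show ?thesis using True by (simp add: c_def ip_def)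
  next
    case False
    then have "c * c * N = 1" using N0 by (simp add: c_def field_simps)
    then show ?thesis by (simp add: ip_scale bN mult_ac)
  qed
  have b'span: "b' \<in> fun_vs.span (insert b B)"
  proof -
    have "e k \<in> fun_vs.span (insert b B)" if "k < card B" for k
      using e(1)[OF that] fun_vs.span_mono[of B "insert b B"] by blast
    then show ?thesis
      unfolding b'_def by (intro fun_vs.span_diff fun_vs.span_sum fun_vs.span_scale) (simp_all add: fun_vs.span_base)
  qed
  have span': "e' k \<in> fun_vs.span (insert b B)" if "k < card (insert b B)" for k
    using that e(1)[of k] insert.hyps fun_vs.span_mono[of B "insert b B"] fun_vs.span_scale[OF b'span, of c]
    by (cases "k = card B") (auto simp: e'_def)
  have pars: "ip f g = (\<Sum>k<card (insert b B). ip f (e' k) * ip (e' k) g)" if f_span: "f \<in> fun_vs.span (insert b B)" for f g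
  proof -
    obtain a where a: "f - (\<lambda>v. a * b v) \<in> fun_vs.span B"
      using f_span unfolding fun_vs.span_insert by blast
    define h where "h = f - (\<lambda>v. a * b v)"
    have f: "f = h + (\<lambda>v. a * b v)" by (auto simp: h_def)
    have h: "h \<in> fun_vs.span B" using a by (simp add: h_def)
    have sumeq: "(\<Sum>k<card (insert b B). ip f (e' k) * ip (e' k) g) =
       (\<Sum>k<card B. ip f (e k) * ip (e k) g) + ip f (\<lambda>v. c * b' v) * ip (\<lambda>v. c * b' v) g"
      using insert.hyps by (simp add: e'_def)
    have "(\<Sum>k<card B. ip f (e k) * ip (e k) g) =
        (\<Sum>k<card B. ip h (e k) * ip (e k) g) + a * (\<Sum>k<card B. ip b (e k) * ip (e k) g)"
      unfolding f by (simp add: ip_add ip_scale algebra_simps sum.distrib sum_distrib_left)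
    also have "(\<Sum>k<card B. ip h (e k) * ip (e k) g) = ip h g" by (rule e(2)[OF h, symmetric])
    also have "(\<Sum>k<card B. ip b (e k) * ip (e k) g) = ip b g - ip b' g" by (simp add: bb')
    finally have 1: "(\<Sum>k<card B. ip f (e k) * ip (e k) g) = ip h g + a * (ip b g - ip b' g)" .
    have "ip f (\<lambda>v. c * b' v) * ip (\<lambda>v. c * b' v) g = a * (ip b (\<lambda>v. c * b' v) * ip (\<lambda>v. c * b' v) g)"
      unfolding f by (simp add: ip_add ip_scale orth[OF h])
    also have "\<dots> = a * ip b' g" by (simp only: key[symmetric])
    finally have 2: "ip f (\<lambda>v. c * b' v) * ip (\<lambda>v. c * b' v) g = a * ip b' g" .
    have "ip f g = ip h g + a * ip b g" unfolding f by (simp add: ip_add ip_scale)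
    then show ?thesis unfolding sumeq 1 2 by (simp add: algebra_simps)
  qed
  show ?case
    using span' pars unfolding ip_def by blast
qed

section \<open>The bound m(r)\<close>

lemma max_order_add_2: "2 \<le> r \<Longrightarrow> max_order (r + 2) = 2 * max_order r + 2"
proof -
  assume r: "2 \<le> r"
  show ?thesis
  proof (cases "even r")
    case True
    then obtain k where k: "r = 2 * k" by blast
    obtain q where "(2::nat) ^ k = Suc q" using not0_implies_Suc[of "2 ^ k"] by auto
    then show ?thesis unfolding k max_order_def by simp
  next
    case False
    then obtain k where k: "r = 2 * k + 1" by (blast elim: oddE)
    with r have "k \<ge> 1" by simp
    then obtain j where j: "k = Suc j" by (cases k) auto
    have "(5::nat) * 2 ^ j \<ge> 2" using one_le_power[of "2::nat" j] by linarith
    then show ?thesis unfolding k j max_order_def by simp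
  qed
qed

lemma max_order_add_double: "2 \<le> r \<Longrightarrow> max_order (r + 2 * k) + 2 = 2 ^ k * (max_order r + 2)"
proof (induction k)
  case (Suc k)
  then show ?case using max_order_add_2[of "r + 2 * k"] by (simp add: algebra_simps)
qed simp

text \<open>The quotient of \<open>m + 2\<close> at consecutive ranks alternates between 5/4 and
  8/5; this is the weaker of the two.\<close>

lemma max_order_Suc: "2 \<le> r \<Longrightarrow> 5 * (max_order r + 2) \<le> 4 * (max_order (Suc r) + 2)"
proof -
  assume r: "2 \<le> r"
  show ?thesis
  proof (cases "even r")
    case True
    then obtain k where k: "r = 2 * k" by blast
    with r have "k \<ge> 1" by simp
    then obtain j where j: "k = Suc j" by (cases k) auto
    have "(5::nat) * 2 ^ j \<ge> 2" using one_le_power[of "2::nat" j] by linarith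
    then show ?thesis unfolding k j max_order_def by simp
  next
    case False
    then obtain k where k: "r = 2 * k + 1" by (blast elim: oddE)
    with r have "k \<ge> 1" by simp
    then obtain j where j: "k = Suc j" by (cases k) auto
    have "(5::nat) * 2 ^ j \<ge> 2" using one_le_power[of "2::nat" j] by linarith
    then show ?thesis unfolding k j max_order_def by simp
  qed
qed

lemma max_order_mono:
  assumes "2 \<le> r" "r \<le> s"
  shows "max_order r \<le> max_order s"
  using assms(2)
proof (induction s rule: dec_induct)
  case (step s)
  then have "5 * (max_order s + 2) \<le> 4 * (max_order (Suc s) + 2)"
    using assms(1) by (intro max_order_Suc) simp
  moreover have "a \<le> c" if "a \<le> b" "5 * (b + 2) \<le> 4 * (c + 2)" for a b c :: nat
    using that by presburger
  ultimately show ?case using step.IH by blast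
qed simp

lemma max_order_47: "max_order 47 = 20971518" and max_order_48: "max_order 48 = 33554430"
  by (simp_all add: max_order_def)

text \<open>The opposite of the final cap estimate, squared to remove the square root. A step of two
  multiplies the right side by at least 4 * (16/25)^2 = 1024/625 and the left side by only (s +
  3)/(s + 1); the two parities need separate base cases.\<close>

lemma cap_bound_violated:
  fixes r :: nat
  assumes "47 \<le> r"
  shows "7200 * (real r + 1) < (real (max_order r) + 1)\<^sup>2 * (61/50)\<^sup>2 * (16/25) ^ r"
  using assms
proof (induction r rule: less_induct)
  case (less r)
  consider "r = 47" | "r = 48" | "49 \<le> r" using less.prems by linarith
  then show ?case
  proof cases
    case 1
    then show ?thesis by (simp add: max_order_47 power_divide)
  next
    case 2
    then show ?thesis by (simp add: max_order_48 power_divide)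
  next
    case 3
    define s where "s = r - 2"
    have s: "r = s + 2" "47 \<le> s" using 3 by (auto simp: s_def)
    let ?x = "real (max_order s) + 1"
    have IH: "7200 * (real s + 1) < ?x\<^sup>2 * (61/50)\<^sup>2 * (16/25) ^ s" using less.IH[of s] s by simp
    have "real (max_order r) + 1 \<ge> 2 * ?x" using max_order_add_2[of s] s by simp
    then have "(2 * ?x)\<^sup>2 \<le> (real (max_order r) + 1)\<^sup>2" by (intro power_mono) auto
    then have "(2 * ?x)\<^sup>2 * ((61/50)\<^sup>2 * (16/25) ^ r) \<le> (real (max_order r) + 1)\<^sup>2 * ((61/50)\<^sup>2 * (16/25) ^ r)"
      by (rule mult_right_mono) simp
    moreover have "(2 * ?x)\<^sup>2 * ((61/50)\<^sup>2 * (16/25) ^ r) = (1024/625) * (?x\<^sup>2 * (61/50)\<^sup>2 * (16/25) ^ s)"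
      unfolding s(1) by (simp add: power_add power2_eq_square algebra_simps)
    moreover have "7200 * (real r + 1) \<le> (1024/625) * (7200 * (real s + 1))" using s by simp
    ultimately show ?thesis using IH by linarith
  qed
qed

section \<open>Volume of spherical caps\<close>

lemma nn_integral_lborel_swap:
  fixes G :: "real \<Rightarrow> real \<Rightarrow> ennreal"
  assumes [measurable]: "case_prod G \<in> borel_measurable (borel \<Otimes>\<^sub>M borel)"
  shows "(\<integral>\<^sup>+b. \<integral>\<^sup>+a. G a b \<partial>lborel \<partial>lborel) = (\<integral>\<^sup>+a. \<integral>\<^sup>+b. G a b \<partial>lborel \<partial>lborel)"
  by (rule lborel_pair.Fubini') measurable

text \<open>For \<open>c\<close> nonzero the rotation is two affine substitutions, each in one
  variable with the other fixed, whose factors 1/|c| and |c| cancel. For \<open>c = 0\<close> it is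
  a swap with a reflection.\<close>

lemma nn_integral_lborel_rotate:
  fixes G :: "real \<Rightarrow> real \<Rightarrow> ennreal" and c s :: real
  assumes G[measurable]: "case_prod G \<in> borel_measurable (borel \<Otimes>\<^sub>M borel)"
    and cs: "c\<^sup>2 + s\<^sup>2 = 1"
  shows "(\<integral>\<^sup>+b. \<integral>\<^sup>+a. G (c * a + s * b) (c * b - s * a) \<partial>lborel \<partial>lborel) =
         (\<integral>\<^sup>+b. \<integral>\<^sup>+a. G a b \<partial>lborel \<partial>lborel)"
proof (cases "c = 0")
  case True
  with cs have s: "s \<noteq> 0" "\<bar>s\<bar> = 1" by (auto simp: abs_square_eq_1)
  have "(\<integral>\<^sup>+b. \<integral>\<^sup>+a. G a b \<partial>lborel \<partial>lborel) = (\<integral>\<^sup>+a. \<integral>\<^sup>+b. G a b \<partial>lborel \<partial>lborel)"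
    by (rule nn_integral_lborel_swap) measurable
  also have "\<dots> = (\<integral>\<^sup>+a. \<integral>\<^sup>+b. G a (0 + (-s) * b) \<partial>lborel \<partial>lborel)"
  proof (rule nn_integral_cong)
    fix a :: real
    show "(\<integral>\<^sup>+b. G a b \<partial>lborel) = (\<integral>\<^sup>+b. G a (0 + (-s) * b) \<partial>lborel)"
      using s nn_integral_real_affine[of "\<lambda>b. G a b" "-s" 0] by simp
  qed
  also have "\<dots> = (\<integral>\<^sup>+a. \<integral>\<^sup>+b. G (0 + s * a) (0 + (-s) * b) \<partial>lborel \<partial>lborel)"
    using s by (subst nn_integral_real_affine[where t = 0 and c = s]) auto
  finally show ?thesis using True by simp
next
  case False
  have sub: "c * ((a' - s * b) / c) + s * b = a'" for a' b using False by simp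
  have sub2: "c * b - s * ((a' - s * b) / c) = (b - s * a') / c" for a' b
  proof -
    have "c * b - s * ((a' - s * b) / c) = ((c\<^sup>2 + s\<^sup>2) * b - s * a') / c"
      using False by (simp add: field_simps power2_eq_square)
    then show ?thesis by (simp add: cs)
  qed
  have "(\<integral>\<^sup>+b. \<integral>\<^sup>+a. G (c * a + s * b) (c * b - s * a) \<partial>lborel \<partial>lborel) =
        (\<integral>\<^sup>+b. ennreal \<bar>1/c\<bar> * (\<integral>\<^sup>+a'. G a' ((b - s * a') / c) \<partial>lborel) \<partial>lborel)"
  proof (rule nn_integral_cong)
    fix b :: real
    have "(\<integral>\<^sup>+a. G (c * a + s * b) (c * b - s * a) \<partial>lborel) =
       ennreal \<bar>1/c\<bar> * (\<integral>\<^sup>+a'. G (c * (- (s * b / c) + 1/c * a') + s * b) (c * b - s * (- (s * b / c) + 1/c * a')) \<partial>lborel)"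
      using False by (intro nn_integral_real_affine) auto
    also have "(\<lambda>a'. - (s * b / c) + 1/c * a') = (\<lambda>a'. (a' - s * b) / c)"
      by (auto simp: fun_eq_iff diff_divide_distrib)
    then have *: "- (s * b / c) + 1/c * a' = (a' - s * b) / c" for a' by (simp add: fun_eq_iff)
    have "(\<integral>\<^sup>+a'. G (c * (- (s * b / c) + 1/c * a') + s * b) (c * b - s * (- (s * b / c) + 1/c * a')) \<partial>lborel)
       = (\<integral>\<^sup>+a'. G a' ((b - s * a') / c) \<partial>lborel)"
      by (simp only: * sub sub2)
    finally show "(\<integral>\<^sup>+a. G (c * a + s * b) (c * b - s * a) \<partial>lborel) =
       ennreal \<bar>1/c\<bar> * (\<integral>\<^sup>+a'. G a' ((b - s * a') / c) \<partial>lborel)" .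
  qed
  also have "\<dots> = ennreal \<bar>1/c\<bar> * (\<integral>\<^sup>+b. \<integral>\<^sup>+a'. G a' ((b - s * a') / c) \<partial>lborel \<partial>lborel)"
    by (rule nn_integral_cmult) measurable
  also have "(\<integral>\<^sup>+b. \<integral>\<^sup>+a'. G a' ((b - s * a') / c) \<partial>lborel \<partial>lborel) =
             (\<integral>\<^sup>+a'. \<integral>\<^sup>+b. G a' ((b - s * a') / c) \<partial>lborel \<partial>lborel)"
    by (rule nn_integral_lborel_swap) measurable
  also have "\<dots> = (\<integral>\<^sup>+a'. ennreal \<bar>c\<bar> * (\<integral>\<^sup>+b. G a' b \<partial>lborel) \<partial>lborel)"
  proof (rule nn_integral_cong)
    fix a' :: real
    have "(\<integral>\<^sup>+b. G a' ((b - s * a') / c) \<partial>lborel) = ennreal \<bar>c\<bar> * (\<integral>\<^sup>+b. G a' ((s * a' + c * b - s * a') / c) \<partial>lborel)"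
      using False by (intro nn_integral_real_affine) auto
    then show "(\<integral>\<^sup>+b. G a' ((b - s * a') / c) \<partial>lborel) = ennreal \<bar>c\<bar> * (\<integral>\<^sup>+b. G a' b \<partial>lborel)"
      using False by simp
  qed
  also have "\<dots> = ennreal \<bar>c\<bar> * (\<integral>\<^sup>+a'. \<integral>\<^sup>+b. G a' b \<partial>lborel \<partial>lborel)"
    by (rule nn_integral_cmult) measurable
  also have "(\<integral>\<^sup>+a'. \<integral>\<^sup>+b. G a' b \<partial>lborel \<partial>lborel) = (\<integral>\<^sup>+b. \<integral>\<^sup>+a. G a b \<partial>lborel \<partial>lborel)"
    by (rule nn_integral_lborel_swap[symmetric]) measurable
  finally show ?thesis
    using False by (simp add: mult.assoc[symmetric] ennreal_mult'[symmetric])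
qed

lemma nn_integral_lborel_linear_form_2:
  fixes F :: "real \<Rightarrow> real \<Rightarrow> ennreal" and \<alpha> \<beta> :: real
  assumes F[measurable]: "case_prod F \<in> borel_measurable (borel \<Otimes>\<^sub>M borel)"
  shows "(\<integral>\<^sup>+b. \<integral>\<^sup>+a. F (\<alpha> * a + \<beta> * b) (a\<^sup>2 + b\<^sup>2) \<partial>lborel \<partial>lborel) =
         (\<integral>\<^sup>+b. \<integral>\<^sup>+a. F (sqrt (\<alpha>\<^sup>2 + \<beta>\<^sup>2) * a) (a\<^sup>2 + b\<^sup>2) \<partial>lborel \<partial>lborel)"
proof (cases "\<alpha>\<^sup>2 + \<beta>\<^sup>2 = 0")
  case True
  then show ?thesis by (simp add: sum_power2_eq_zero_iff)
next
  case False
  define m where "m = sqrt (\<alpha>\<^sup>2 + \<beta>\<^sup>2)"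
  have m: "m > 0" "m\<^sup>2 = \<alpha>\<^sup>2 + \<beta>\<^sup>2" using False
    by (auto simp: m_def less_le)
  have cs: "(\<alpha> / m)\<^sup>2 + (\<beta> / m)\<^sup>2 = 1"
    using m False by (simp add: power_divide add_divide_distrib[symmetric])
  have rot: "(p * a + q * b)\<^sup>2 + (p * b - q * a)\<^sup>2 = (p\<^sup>2 + q\<^sup>2) * (a\<^sup>2 + b\<^sup>2)" for p q a b :: real
    by (simp add: power2_eq_square algebra_simps)
  have sq: "(\<alpha> / m * a + \<beta> / m * b)\<^sup>2 + (\<alpha> / m * b - \<beta> / m * a)\<^sup>2 = a\<^sup>2 + b\<^sup>2" for a b
  proof -
    have "(\<alpha> / m * a + \<beta> / m * b)\<^sup>2 + (\<alpha> / m * b - \<beta> / m * a)\<^sup>2 = ((\<alpha> / m)\<^sup>2 + (\<beta> / m)\<^sup>2) * (a\<^sup>2 + b\<^sup>2)"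
      by (rule rot)
    then show ?thesis by (simp add: cs)
  qed
  have ln: "m * (\<alpha> / m * a + \<beta> / m * b) = \<alpha> * a + \<beta> * b" for a b
    using m by (simp add: field_simps)
  have "(\<integral>\<^sup>+b. \<integral>\<^sup>+a. F (m * (\<alpha> / m * a + \<beta> / m * b))
          ((\<alpha> / m * a + \<beta> / m * b)\<^sup>2 + (\<alpha> / m * b - \<beta> / m * a)\<^sup>2) \<partial>lborel \<partial>lborel) =
        (\<integral>\<^sup>+b. \<integral>\<^sup>+a. F (m * a) (a\<^sup>2 + b\<^sup>2) \<partial>lborel \<partial>lborel)"
    using cs by (intro nn_integral_lborel_rotate[where G = "\<lambda>a b. F (m * a) (a\<^sup>2 + b\<^sup>2)"]) measurable
  then show ?thesis unfolding sq ln by (simp add: m_def)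
qed

section \<open>Integration over finite powers of Lebesgue measure\<close>

abbreviation lborel_pow :: "nat \<Rightarrow> (nat \<Rightarrow> real) measure" where
  "lborel_pow n \<equiv> Pi\<^sub>M {..<n} (\<lambda>_. lborel)"

lemma sigma_finite_lborel_pow: "sigma_finite_measure (lborel_pow n)"
proof -
  interpret product_sigma_finite "\<lambda>_::nat. lborel :: real measure" by standard
  show ?thesis by (rule sigma_finite) simp
qed

lemma nn_integral_lborel_pow_Suc:
  fixes F :: "(nat \<Rightarrow> real) \<Rightarrow> ennreal"
  assumes [measurable]: "F \<in> borel_measurable (lborel_pow (Suc n))"
  shows "(\<integral>\<^sup>+y. F y \<partial>lborel_pow (Suc n)) = (\<integral>\<^sup>+b. \<integral>\<^sup>+y. F (y(n := b)) \<partial>lborel_pow n \<partial>lborel)"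
proof -
  interpret product_sigma_finite "\<lambda>_::nat. lborel :: real measure" by standard
  show ?thesis
    unfolding lessThan_Suc using assms
    by (subst product_nn_integral_insert_rev) (auto simp: lessThan_Suc)
qed

text \<open>
  The joint distribution of \<open>x \<bullet> y\<close> and the norm of \<open>y\<close> depends only on the norm of \<open>x\<close>; the induction on
  the dimension needs rotation invariance only in the plane.
\<close>

lemma nn_integral_linear_form_norm:
  fixes F :: "real \<Rightarrow> real \<Rightarrow> ennreal" and x :: "nat \<Rightarrow> real"
  assumes F[measurable]: "case_prod F \<in> borel_measurable (borel \<Otimes>\<^sub>M borel)"
  shows "(\<integral>\<^sup>+y. F (\<Sum>k<Suc n. x k * y k) (\<Sum>k<Suc n. (y k)\<^sup>2) \<partial>lborel_pow (Suc n)) =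
    (\<integral>\<^sup>+a. \<integral>\<^sup>+y. F (sqrt (\<Sum>k<Suc n. (x k)\<^sup>2) * a) (a\<^sup>2 + (\<Sum>k<n. (y k)\<^sup>2)) \<partial>lborel_pow n \<partial>lborel)"
  using F
proof (induction n arbitrary: F)
  case 0
  note [measurable] = 0
  have "(\<integral>\<^sup>+y. F (\<Sum>k<Suc 0. x k * y k) (\<Sum>k<Suc 0. (y k)\<^sup>2) \<partial>lborel_pow (Suc 0)) =
     (\<integral>\<^sup>+a. F (x 0 * a) (a\<^sup>2) \<partial>lborel)"
    by (subst nn_integral_lborel_pow_Suc) (auto simp: nn_integral_empty PiM_empty nn_integral_count_space_finite)
  also have "\<dots> = (\<integral>\<^sup>+a. F (\<bar>x 0\<bar> * a) (a\<^sup>2) \<partial>lborel)"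
  proof (cases "x 0 \<ge> 0")
    case False
    then show ?thesis
      by (subst nn_integral_real_affine[where t = 0 and c = "-1"]) auto
  qed simp
  finally show ?case by (simp add: PiM_empty nn_integral_count_space_finite)
next
  case (Suc n)
  note [measurable] = Suc.prems
  interpret ps: sigma_finite_measure "lborel_pow n" by (rule sigma_finite_lborel_pow)
  interpret pp: pair_sigma_finite "lborel_pow n" "lborel :: real measure" by standard
  define \<alpha> where "\<alpha> = sqrt (\<Sum>k<Suc n. (x k)\<^sup>2)"
  define \<beta> where "\<beta> = x (Suc n)"
  have \<alpha>2: "\<alpha>\<^sup>2 = (\<Sum>k<Suc n. (x k)\<^sup>2)"
    unfolding \<alpha>_def by (intro real_sqrt_pow2 sum_nonneg) auto
  have "(\<integral>\<^sup>+y. F (\<Sum>k<Suc (Suc n). x k * y k) (\<Sum>k<Suc (Suc n). (y k)\<^sup>2) \<partial>lborel_pow (Suc (Suc n))) =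
    (\<integral>\<^sup>+b. \<integral>\<^sup>+y. F ((\<Sum>k<Suc n. x k * y k) + \<beta> * b) ((\<Sum>k<Suc n. (y k)\<^sup>2) + b\<^sup>2) \<partial>lborel_pow (Suc n) \<partial>lborel)"
  proof (subst nn_integral_lborel_pow_Suc)
    have e1: "(\<Sum>k<Suc n. x k * (y(Suc n := b)) k) = (\<Sum>k<Suc n. x k * y k)" for y and b :: real
      by (intro sum.cong) auto
    have e2: "(\<Sum>k<Suc n. ((y(Suc n := b)) k)\<^sup>2) = (\<Sum>k<Suc n. (y k)\<^sup>2)" for y and b :: real
      by (intro sum.cong) auto
    show "(\<integral>\<^sup>+b. \<integral>\<^sup>+y. F (\<Sum>k<Suc (Suc n). x k * (y(Suc n := b)) k) (\<Sum>k<Suc (Suc n). ((y(Suc n := b)) k)\<^sup>2)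
         \<partial>lborel_pow (Suc n) \<partial>lborel) =
      (\<integral>\<^sup>+b. \<integral>\<^sup>+y. F ((\<Sum>k<Suc n. x k * y k) + \<beta> * b) ((\<Sum>k<Suc n. (y k)\<^sup>2) + b\<^sup>2) \<partial>lborel_pow (Suc n) \<partial>lborel)"
      unfolding sum.lessThan_Suc[of _ "Suc n"] e1 e2 by (simp add: \<beta>_def)
  qed measurable
  \<comment> \<open>The induction hypothesis, applied to \<open>F\<close> shifted by the last
    coordinate \<open>b\<close>, replaces the other coordinates by one coordinate \<open>a\<close>.
    Fubini then makes \<open>a\<close> and \<open>b\<close> adjacent, so that a plane rotation
    merges their coefficients and \<open>b\<close> joins the remaining coordinates.\<close>
  also have "\<dots> = (\<integral>\<^sup>+b. \<integral>\<^sup>+a. \<integral>\<^sup>+y. F (\<alpha> * a + \<beta> * b) (a\<^sup>2 + (\<Sum>k<n. (y k)\<^sup>2) + b\<^sup>2) \<partial>lborel_pow n \<partial>lborel \<partial>lborel)"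
    unfolding \<alpha>_def
    by (intro nn_integral_cong Suc.IH[where F = "\<lambda>s q. F (s + \<beta> * b) (q + b\<^sup>2)" for b]) measurable
  also have "\<dots> = (\<integral>\<^sup>+b. \<integral>\<^sup>+y. \<integral>\<^sup>+a. F (\<alpha> * a + \<beta> * b) (a\<^sup>2 + (\<Sum>k<n. (y k)\<^sup>2) + b\<^sup>2) \<partial>lborel \<partial>lborel_pow n \<partial>lborel)"
    by (intro nn_integral_cong pp.Fubini') measurable
  also have "\<dots> = (\<integral>\<^sup>+y. \<integral>\<^sup>+b. \<integral>\<^sup>+a. F (\<alpha> * a + \<beta> * b) (a\<^sup>2 + (\<Sum>k<n. (y k)\<^sup>2) + b\<^sup>2) \<partial>lborel \<partial>lborel \<partial>lborel_pow n)"
    by (intro pp.Fubini') measurable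
  also have "\<dots> = (\<integral>\<^sup>+y. \<integral>\<^sup>+b. \<integral>\<^sup>+a. F (sqrt (\<alpha>\<^sup>2 + \<beta>\<^sup>2) * a) (a\<^sup>2 + b\<^sup>2 + (\<Sum>k<n. (y k)\<^sup>2)) \<partial>lborel \<partial>lborel \<partial>lborel_pow n)"
  proof (rule nn_integral_cong)
    fix y :: "nat \<Rightarrow> real"
    show "(\<integral>\<^sup>+b. \<integral>\<^sup>+a. F (\<alpha> * a + \<beta> * b) (a\<^sup>2 + (\<Sum>k<n. (y k)\<^sup>2) + b\<^sup>2) \<partial>lborel \<partial>lborel) =
      (\<integral>\<^sup>+b. \<integral>\<^sup>+a. F (sqrt (\<alpha>\<^sup>2 + \<beta>\<^sup>2) * a) (a\<^sup>2 + b\<^sup>2 + (\<Sum>k<n. (y k)\<^sup>2)) \<partial>lborel \<partial>lborel)"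
      using nn_integral_lborel_linear_form_2[of "\<lambda>s q. F s (q + (\<Sum>k<n. (y k)\<^sup>2))" \<alpha> \<beta>]
      by (simp add: add_ac)
  qed
  also have "\<dots> = (\<integral>\<^sup>+b. \<integral>\<^sup>+y. \<integral>\<^sup>+a. F (sqrt (\<alpha>\<^sup>2 + \<beta>\<^sup>2) * a) (a\<^sup>2 + b\<^sup>2 + (\<Sum>k<n. (y k)\<^sup>2)) \<partial>lborel \<partial>lborel_pow n \<partial>lborel)"
    by (intro pp.Fubini'[symmetric]) measurable
  also have "\<dots> = (\<integral>\<^sup>+b. \<integral>\<^sup>+a. \<integral>\<^sup>+y. F (sqrt (\<alpha>\<^sup>2 + \<beta>\<^sup>2) * a) (a\<^sup>2 + b\<^sup>2 + (\<Sum>k<n. (y k)\<^sup>2)) \<partial>lborel_pow n \<partial>lborel \<partial>lborel)"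
    by (intro nn_integral_cong pp.Fubini'[symmetric]) measurable
  also have "\<dots> = (\<integral>\<^sup>+a. \<integral>\<^sup>+b. \<integral>\<^sup>+y. F (sqrt (\<alpha>\<^sup>2 + \<beta>\<^sup>2) * a) (a\<^sup>2 + b\<^sup>2 + (\<Sum>k<n. (y k)\<^sup>2)) \<partial>lborel_pow n \<partial>lborel \<partial>lborel)"
    by (intro nn_integral_lborel_swap) measurable
  also have "\<dots> = (\<integral>\<^sup>+a. \<integral>\<^sup>+y. F (sqrt (\<alpha>\<^sup>2 + \<beta>\<^sup>2) * a) (a\<^sup>2 + (\<Sum>k<Suc n. (y k)\<^sup>2)) \<partial>lborel_pow (Suc n) \<partial>lborel)"
  proof (rule nn_integral_cong)
    fix a :: real
    have e2: "a\<^sup>2 + (\<Sum>k<Suc n. ((y(n := b)) k)\<^sup>2) = a\<^sup>2 + b\<^sup>2 + (\<Sum>k<n. (y k)\<^sup>2)" for y and b :: real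
      by simp
    have "(\<integral>\<^sup>+y. F (sqrt (\<alpha>\<^sup>2 + \<beta>\<^sup>2) * a) (a\<^sup>2 + (\<Sum>k<Suc n. (y k)\<^sup>2)) \<partial>lborel_pow (Suc n)) =
      (\<integral>\<^sup>+b. \<integral>\<^sup>+y. F (sqrt (\<alpha>\<^sup>2 + \<beta>\<^sup>2) * a) (a\<^sup>2 + (\<Sum>k<Suc n. ((y(n := b)) k)\<^sup>2)) \<partial>lborel_pow n \<partial>lborel)"
      by (rule nn_integral_lborel_pow_Suc) measurable
    then show "(\<integral>\<^sup>+b. \<integral>\<^sup>+y. F (sqrt (\<alpha>\<^sup>2 + \<beta>\<^sup>2) * a) (a\<^sup>2 + b\<^sup>2 + (\<Sum>k<n. (y k)\<^sup>2)) \<partial>lborel_pow n \<partial>lborel) =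
      (\<integral>\<^sup>+y. F (sqrt (\<alpha>\<^sup>2 + \<beta>\<^sup>2) * a) (a\<^sup>2 + (\<Sum>k<Suc n. (y k)\<^sup>2)) \<partial>lborel_pow (Suc n))"
      by (simp only: e2)
  qed
  finally show ?case by (simp add: \<alpha>2 \<beta>_def)
qed

text \<open>The quotient of the volumes is sqrt pi * Gamma x / Gamma (x + 1/2). Log-convexity at the
  midpoint of x - 1/2 and x + 1/2, with the functional equation, bounds it.\<close>

lemma unit_ball_vol_Suc_le:
  "unit_ball_vol (real (Suc n)) \<le> sqrt (2 * pi / real (Suc n)) * unit_ball_vol (real n)"
proof -
  define x :: real where "x = real n / 2 + 1"
  have x: "x - 1/2 > 0" "x > 0" by (simp_all add: x_def)
  have G: "Gamma (x - 1/2) > 0" "Gamma (x + 1/2) > 0" "Gamma x > 0"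
    using x by (auto intro!: Gamma_real_pos)
  have "ln (Gamma ((1 - 1/2) *\<^sub>R (x - 1/2) + (1/2) *\<^sub>R (x + 1/2))) \<le>
      (1 - 1/2) * ln (Gamma (x - 1/2)) + 1/2 * ln (Gamma (x + 1/2))"
    using x convex_onD[OF log_convex_Gamma_real, of "1/2" "x - 1/2" "x + 1/2"] by (simp add: o_def)
  also have "(1 - 1/2) *\<^sub>R (x - 1/2) + (1/2) *\<^sub>R (x + 1/2) = x" by (simp add: field_simps)
  finally have "2 * ln (Gamma x) \<le> ln (Gamma (x - 1/2)) + ln (Gamma (x + 1/2))" by simp
  then have "ln ((Gamma x)\<^sup>2) \<le> ln (Gamma (x - 1/2) * Gamma (x + 1/2))"
    using G by (simp add: ln_mult power2_eq_square)
  then have "(Gamma x)\<^sup>2 \<le> Gamma (x - 1/2) * Gamma (x + 1/2)"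
    using G by (subst (asm) ln_le_cancel_iff) auto
  also have "Gamma (x + 1/2) = (x - 1/2) * Gamma (x - 1/2)"
  proof -
    have "x - 1/2 \<notin> \<int>\<^sub>\<le>\<^sub>0" using x by (auto dest: nonpos_Ints_nonpos)
    from Gamma_plus1[OF this] show ?thesis by (simp add: algebra_simps)
  qed
  finally have "(x - 1/2) * (Gamma x)\<^sup>2 \<le> ((x - 1/2) * Gamma (x - 1/2))\<^sup>2"
    using x by (simp add: power2_eq_square mult_ac)
  then have "(x - 1/2) * (Gamma x)\<^sup>2 \<le> (Gamma (x + 1/2))\<^sup>2"
    using \<open>Gamma (x + 1/2) = _\<close> by simp
  then have "(sqrt (x - 1/2) * Gamma x)\<^sup>2 \<le> (Gamma (x + 1/2))\<^sup>2"
    using x by (simp only: power_mult_distrib real_sqrt_pow2 less_imp_le)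
  then have "sqrt (x - 1/2) * Gamma x \<le> Gamma (x + 1/2)"
    using less_imp_le[OF G(2)] by (rule power2_le_imp_le)
  then have le: "Gamma x / Gamma (x + 1/2) \<le> 1 / sqrt (x - 1/2)"
    using G(2) real_sqrt_gt_zero[OF x(1)] by (simp only: divide_le_eq le_divide_eq mult_1 mult.commute times_divide_eq_right if_True)
  have x2: "x - 1/2 = real (Suc n) / 2" by (simp add: x_def field_simps)
  have "Gamma (1 + real n / 2) \<noteq> 0" using G(3) unfolding x_def by (metis add.commute less_irrefl)
  then have "unit_ball_vol (real (Suc n)) = sqrt pi * (Gamma x / Gamma (x + 1/2)) * unit_ball_vol (real n)"
    by (simp add: unit_ball_vol_def x_def add_divide_distrib powr_add powr_half_sqrt add_ac)
  also have "\<dots> \<le> sqrt pi * (1 / sqrt (x - 1/2)) * unit_ball_vol (real n)"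
    using le by (intro mult_right_mono mult_left_mono) auto
  also have "sqrt pi * (1 / sqrt (x - 1/2)) = sqrt (2 * pi / real (Suc n))"
    unfolding x2 by (simp add: real_sqrt_divide real_sqrt_mult)
  finally show ?thesis .
qed

text \<open>
  The threshold \<open>3/5\<close> is just above \<open>sqrt (1/3)\<close>, where a cap can no longer contain many vectors with
  mean inner product \<open>1/3\<close>, and makes the radius \<open>4/5\<close> of the base of the cap rational.
\<close>

definition unit_cap :: "nat \<Rightarrow> (nat \<Rightarrow> real) \<Rightarrow> (nat \<Rightarrow> real) set" where
  "unit_cap n x = {y \<in> space (lborel_pow n). 0 < (\<Sum>k<n. (y k)\<^sup>2) \<and> (\<Sum>k<n. (y k)\<^sup>2) \<le> 1 \<and>
     3/5 * sqrt (\<Sum>k<n. (y k)\<^sup>2) \<le> (\<Sum>k<n. x k * y k)}"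

lemma unit_cap_measurable [measurable]: "unit_cap n x \<in> sets (lborel_pow n)"
proof -
  have [measurable]: "(\<lambda>y. \<Sum>k<n. x k * y k) \<in> borel_measurable (lborel_pow n)"
    "(\<lambda>y. \<Sum>k<n. (y k)\<^sup>2) \<in> borel_measurable (lborel_pow n)"
    by measurable
  have "unit_cap n x = {y \<in> space (lborel_pow n). 0 < (\<Sum>k<n. (y k)\<^sup>2)} \<inter>
     {y \<in> space (lborel_pow n). (\<Sum>k<n. (y k)\<^sup>2) \<le> 1} \<inter>
     {y \<in> space (lborel_pow n). 3/5 * sqrt (\<Sum>k<n. (y k)\<^sup>2) \<le> (\<Sum>k<n. x k * y k)}"
    by (auto simp: unit_cap_def)
  also have "\<dots> \<in> sets (lborel_pow n)"
    by (intro sets.Int borel_measurable_le borel_measurable_less) measurable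
  finally show ?thesis .
qed

text \<open>Multiplying the integrand by \<open>a\<close> makes the antiderivative elementary; on
  the interval this loses a factor of at most 5/3.\<close>

lemma nn_integral_cap_profile:
  "ennreal ((4/5) ^ (n + 2) / (real n + 2)) \<le> (\<integral>\<^sup>+a. indicator {3/5..1} a * ennreal (sqrt (1 - a\<^sup>2) ^ n) \<partial>lborel)"
proof -
  have "((\<lambda>a. a * sqrt (1 - a\<^sup>2) ^ n) has_integral
      (- (sqrt (1 - 1\<^sup>2) ^ (n + 2) / (real n + 2)) - (- (sqrt (1 - (3/5)\<^sup>2) ^ (n + 2) / (real n + 2))))) {3/5..1}"
  proof (rule fundamental_theorem_of_calculus_interior)
    show "continuous_on {3/5..1} (\<lambda>a. - (sqrt (1 - a\<^sup>2) ^ (n + 2) / (real n + 2)))"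
      by (intro continuous_intros) auto
    fix a :: real assume "a \<in> {3/5<..<1}"
    then have a: "a\<^sup>2 < 1" by (simp add: power_less_one_iff)
    then have s: "sqrt (1 - a\<^sup>2) > 0" by simp
    have "((\<lambda>a. sqrt (1 - a\<^sup>2)) has_real_derivative - (a / sqrt (1 - a\<^sup>2))) (at a)"
      using a by (auto intro!: derivative_eq_intros simp: divide_simps)
    then have "((\<lambda>a. - (sqrt (1 - a\<^sup>2) ^ (n + 2) / (real n + 2))) has_real_derivative
        - (of_nat (n + 2) * (- (a / sqrt (1 - a\<^sup>2)) * sqrt (1 - a\<^sup>2) ^ (n + 2 - Suc 0)) / (real n + 2))) (at a)"
      by (intro DERIV_minus DERIV_cdivide DERIV_power)
    moreover have "- (a / sqrt (1 - a\<^sup>2)) * sqrt (1 - a\<^sup>2) ^ (n + 2 - Suc 0) = - (a * sqrt (1 - a\<^sup>2) ^ n)"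
      using s less_imp_neq[OF a] by simp
    moreover have "- (of_nat (n + 2) * (- (a * sqrt (1 - a\<^sup>2) ^ n)) / (real n + 2)) = a * sqrt (1 - a\<^sup>2) ^ n"
      by (simp add: nonzero_divide_eq_eq add_nonneg_eq_0_iff)
    ultimately show "((\<lambda>a. - (sqrt (1 - a\<^sup>2) ^ (n + 2) / (real n + 2))) has_vector_derivative a * sqrt (1 - a\<^sup>2) ^ n) (at a)"
      by (simp only: has_real_derivative_iff_has_vector_derivative)
  qed auto
  also have "sqrt (1 - (3/5)\<^sup>2 :: real) = 4/5" by (rule real_sqrt_unique) (auto simp: power2_eq_square)
  finally have hi: "((\<lambda>a. a * sqrt (1 - a\<^sup>2) ^ n) has_integral (4/5) ^ (n + 2) / (real n + 2)) {3/5..1}" by simp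
  have "ennreal ((4/5) ^ (n + 2) / (real n + 2)) = (\<integral>\<^sup>+a. indicator {3/5..1} a * ennreal (a * sqrt (1 - a\<^sup>2) ^ n) \<partial>lborel)"
  proof -
    have nn: "0 \<le> a * sqrt (1 - a\<^sup>2) ^ n" if "a \<in> {3/5..1}" for a :: real
      using that by (intro mult_nonneg_nonneg zero_le_power) (auto simp: power_le_one)
    have "(\<integral>\<^sup>+a. ennreal (indicator {3/5..1} a * (a * sqrt (1 - a\<^sup>2) ^ n)) \<partial>lborel) = ennreal ((4/5) ^ (n + 2) / (real n + 2))"
      by (rule nn_integral_has_integral_lebesgue[OF nn hi])
    then show ?thesis
      by (simp add: ennreal_mult' ennreal_indicator)
  qed
  also have "\<dots> \<le> (\<integral>\<^sup>+a. indicator {3/5..1} a * ennreal (sqrt (1 - a\<^sup>2) ^ n) \<partial>lborel)"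
  proof (intro nn_integral_mono)
    fix a :: real
    show "indicator {3/5..1} a * ennreal (a * sqrt (1 - a\<^sup>2) ^ n) \<le> indicator {3/5..1} a * ennreal (sqrt (1 - a\<^sup>2) ^ n)"
    proof (cases "a \<in> {3/5..1}")
      case True
      then have "a * sqrt (1 - a\<^sup>2) ^ n \<le> 1 * sqrt (1 - a\<^sup>2) ^ n"
        by (intro mult_right_mono zero_le_power) (auto simp: power_le_one)
      with True show ?thesis by (simp add: ennreal_leI)
    qed simp
  qed
  finally show ?thesis .
qed

text \<open>The slice of the cone at height \<open>a\<close> has radius 4a/3, because 3/5 * sqrt
  (a^2 + h) <= a means h <= (4a/3)^2 for nonnegative a.\<close>

lemma nn_integral_cone_profile:
  "(\<integral>\<^sup>+a. indicator {0..3/5} a * ennreal ((4 * a / 3) ^ n) \<partial>lborel) = ennreal (3/5 / (real n + 1) * (4/5) ^ n)"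
proof -
  have "(\<integral>\<^sup>+a. ennreal ((4 * a / 3) ^ n) * indicator {0..3/5} a \<partial>lborel) =
      ennreal ((3/4) * (4 * (3/5) / 3) ^ (n + 1) / (real n + 1) - (3/4) * (4 * 0 / 3) ^ (n + 1) / (real n + 1))"
  proof (rule nn_integral_FTC_Icc)
    show "((\<lambda>a. (3/4) * (4 * a / 3) ^ (n + 1) / (real n + 1)) has_real_derivative (4 * a / 3) ^ n) (at a)" for a :: real
    proof -
      have "((\<lambda>a. 4 * a / 3) has_real_derivative 4/3) (at a)"
        by (auto intro!: derivative_eq_intros)
      from DERIV_power[OF this, of "n + 1"]
      have "((\<lambda>a. (4 * a / 3) ^ (n + 1)) has_real_derivative (real n + 1) * (4/3 * (4 * a / 3) ^ n)) (at a)"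
        by (simp add: add.commute)
      from DERIV_cdivide[OF DERIV_cmult[OF this, of "3/4"], of "real n + 1"] show ?thesis
        by (simp add: add_nonneg_eq_0_iff)
    qed
  qed auto
  then show ?thesis by (simp add: mult.commute)
qed

text \<open>\<open>unit_cap\<close> is the solid sector of the unit ball over a spherical cap.
  Sliced orthogonally to \<open>x\<close>, it is a cone up to height 3/5 and is bounded by the
  sphere, with slice radius sqrt (1 - a^2), above it.\<close>

lemma emeasure_unit_cap:
  assumes x: "(\<Sum>k<Suc n. (x k)\<^sup>2) = 1"
  shows "ennreal (unit_ball_vol n * (3/5 / (real n + 1) * (4/5) ^ n + (4/5) ^ (n + 2) / (real n + 2)))
     \<le> emeasure (lborel_pow (Suc n)) (unit_cap (Suc n) x)"
proof -
  define F :: "real \<Rightarrow> real \<Rightarrow> ennreal" where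
    "F = (\<lambda>s q. if 0 < q \<and> q \<le> 1 \<and> 3/5 * sqrt q \<le> s then 1 else 0)"
  have [measurable]: "case_prod F \<in> borel_measurable (borel \<Otimes>\<^sub>M borel)"
    unfolding F_def by measurable
  define B :: "real \<Rightarrow> (nat \<Rightarrow> real) set" where
    "B r = {f. sqrt (\<Sum>i<n. (f i)\<^sup>2) \<le> r} \<inter> space (lborel_pow n)" for r
  have B[measurable]: "B r \<in> sets (lborel_pow n)" for r
  proof -
    have "B r = {f \<in> space (lborel_pow n). sqrt (\<Sum>i<n. (f i)\<^sup>2) \<le> r}" by (auto simp: B_def)
    then show ?thesis by simp
  qed
  have eB: "emeasure (lborel_pow n) (B r) = ennreal (unit_ball_vol n * r ^ n)" if "r > 0" for r
    unfolding B_def using emeasure_cball_aux[of "{..<n}" r] that by simp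
  have "ennreal (unit_ball_vol n * (3/5 / (real n + 1) * (4/5) ^ n + (4/5) ^ (n + 2) / (real n + 2))) =
     ennreal (unit_ball_vol n) * (ennreal (3/5 / (real n + 1) * (4/5) ^ n) + ennreal ((4/5) ^ (n + 2) / (real n + 2)))"
    by (simp add: ennreal_mult' ennreal_plus[symmetric] del: ennreal_plus)
  also have "\<dots> \<le> ennreal (unit_ball_vol n) * 
     ((\<integral>\<^sup>+a. indicator {0..3/5} a * ennreal ((4 * a / 3) ^ n) \<partial>lborel) +
      (\<integral>\<^sup>+a. indicator {3/5..1} a * ennreal (sqrt (1 - a\<^sup>2) ^ n) \<partial>lborel))"
    unfolding nn_integral_cone_profile
    by (intro mult_left_mono add_left_mono nn_integral_cap_profile) auto
  also have "\<dots> = (\<integral>\<^sup>+a. ennreal (unit_ball_vol n) * (indicator {0..3/5} a * ennreal ((4 * a / 3) ^ n) +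
       indicator {3/5..1} a * ennreal (sqrt (1 - a\<^sup>2) ^ n)) \<partial>lborel)"
    by (subst nn_integral_cmult, measurable, subst nn_integral_add) (auto intro!: arg_cong2[where f = "(*)"])
  also have "\<dots> \<le> (\<integral>\<^sup>+a. \<integral>\<^sup>+y. F a (a\<^sup>2 + (\<Sum>k<n. (y k)\<^sup>2)) \<partial>lborel_pow n \<partial>lborel)"
  proof (rule nn_integral_mono_AE)
    \<comment> \<open>At 3/5 both indicators count, and at 0 and 1 the slice radius is zero, which
      \<open>main\<close> excludes.\<close>
    have "AE a in lborel. a \<notin> {0, 3/5, 1 :: real}"
      by (intro AE_not_in countable_imp_null_set_lborel) auto
    then show "AE a in lborel. ennreal (unit_ball_vol n) * (indicator {0..3/5} a * ennreal ((4 * a / 3) ^ n) +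
       indicator {3/5..1} a * ennreal (sqrt (1 - a\<^sup>2) ^ n)) \<le> (\<integral>\<^sup>+y. F a (a\<^sup>2 + (\<Sum>k<n. (y k)\<^sup>2)) \<partial>lborel_pow n)"
    proof eventually_elim
      case (elim a)
      have main: "ennreal (unit_ball_vol n * r ^ n) \<le> (\<integral>\<^sup>+y. F a (a\<^sup>2 + (\<Sum>k<n. (y k)\<^sup>2)) \<partial>lborel_pow n)"
        if r: "r > 0" and imp: "\<And>h. 0 \<le> h \<Longrightarrow> h \<le> r\<^sup>2 \<Longrightarrow> a\<^sup>2 + h \<le> 1 \<and> 3/5 * sqrt (a\<^sup>2 + h) \<le> a" for r
      proof -
        have "ennreal (unit_ball_vol n * r ^ n) = (\<integral>\<^sup>+y. indicator (B r) y \<partial>lborel_pow n)"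
          using eB[OF r] by simp
        also have "\<dots> \<le> (\<integral>\<^sup>+y. F a (a\<^sup>2 + (\<Sum>k<n. (y k)\<^sup>2)) \<partial>lborel_pow n)"
        proof (intro nn_integral_mono)
          fix y :: "nat \<Rightarrow> real"
          show "indicator (B r) y \<le> F a (a\<^sup>2 + (\<Sum>k<n. (y k)\<^sup>2))"
          proof (cases "y \<in> B r")
            case True
            have h: "0 \<le> (\<Sum>k<n. (y k)\<^sup>2)" by (intro sum_nonneg) auto
            moreover have "(\<Sum>k<n. (y k)\<^sup>2) \<le> r\<^sup>2"
              using True r h by (auto simp: B_def sqrt_le_D)
            ultimately have "a\<^sup>2 + (\<Sum>k<n. (y k)\<^sup>2) \<le> 1 \<and> 3/5 * sqrt (a\<^sup>2 + (\<Sum>k<n. (y k)\<^sup>2)) \<le> a"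
              by (rule imp)
            moreover have "0 < a\<^sup>2 + (\<Sum>k<n. (y k)\<^sup>2)" using h elim by (simp add: add_pos_nonneg)
            ultimately show ?thesis by (simp add: F_def indicator_def)
          qed simp
        qed
        finally show ?thesis .
      qed
      have "a \<noteq> 0" "a \<noteq> 3/5" "a \<noteq> 1" using elim by auto
      then consider "a < 0 \<or> 1 < a" | "0 < a" "a < 3/5" | "3/5 < a" "a < 1" by linarith
      then show ?case
      proof cases
        case 1
        then show ?thesis by (auto simp: indicator_def)
      next
        case 2
        have "ennreal (unit_ball_vol n * (4 * a / 3) ^ n) \<le> (\<integral>\<^sup>+y. F a (a\<^sup>2 + (\<Sum>k<n. (y k)\<^sup>2)) \<partial>lborel_pow n)"
        proof (rule main)
          fix h :: real assume h: "0 \<le> h" "h \<le> (4 * a / 3)\<^sup>2"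
          then have le: "a\<^sup>2 + h \<le> (5 * a / 3)\<^sup>2" by (simp add: power2_eq_square field_simps)
          also have "(5 * a / 3)\<^sup>2 \<le> 1" using 2 by (intro power_le_one) auto
          finally show "a\<^sup>2 + h \<le> 1 \<and> 3/5 * sqrt (a\<^sup>2 + h) \<le> a"
            using le 2 real_le_lsqrt[of "5 * a / 3" "a\<^sup>2 + h"] by auto
        qed (use 2 in auto)
        then show ?thesis using 2 by (simp add: ennreal_mult')
      next
        case 3
        then have a2: "a\<^sup>2 < 1" by (simp add: power_less_one_iff)
        have "ennreal (unit_ball_vol n * sqrt (1 - a\<^sup>2) ^ n) \<le> (\<integral>\<^sup>+y. F a (a\<^sup>2 + (\<Sum>k<n. (y k)\<^sup>2)) \<partial>lborel_pow n)"
        proof (rule main)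
          fix h :: real assume h: "0 \<le> h" "h \<le> (sqrt (1 - a\<^sup>2))\<^sup>2"
          then have "a\<^sup>2 + h \<le> 1" using a2 by simp
          moreover from this have "sqrt (a\<^sup>2 + h) \<le> 1" by simp
          ultimately show "a\<^sup>2 + h \<le> 1 \<and> 3/5 * sqrt (a\<^sup>2 + h) \<le> a" using 3 by linarith
        qed (use a2 in auto)
        then show ?thesis using 3 by (simp add: ennreal_mult')
      qed
    qed
  qed
  also have "\<dots> = (\<integral>\<^sup>+y. F (\<Sum>k<Suc n. x k * y k) (\<Sum>k<Suc n. (y k)\<^sup>2) \<partial>lborel_pow (Suc n))"
    using nn_integral_linear_form_norm[of F n x] unfolding x by simp
  also have "\<dots> = (\<integral>\<^sup>+y. indicator (unit_cap (Suc n) x) y \<partial>lborel_pow (Suc n))"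
    by (intro nn_integral_cong) (auto simp: F_def unit_cap_def indicator_def)
  finally show ?thesis by simp
qed

text \<open>Double counting: y lies in the sector of g i exactly when g i lies in the cap around y,
  so each point of the unit ball is covered at most \<open>M\<close> times by the sectors. Dividing
  by the volume of the n-dimensional ball leaves the quotient of consecutive ball volumes.\<close>

theorem spherical_cap_bound:
  fixes g :: "'i \<Rightarrow> nat \<Rightarrow> real"
  assumes I: "finite I" and unit: "\<And>i. i \<in> I \<Longrightarrow> (\<Sum>k<Suc n. (g i k)\<^sup>2) = 1"
    and cap: "\<And>y. 0 < (\<Sum>k<Suc n. (y k)\<^sup>2) \<Longrightarrow>
      card {i \<in> I. 3/5 * sqrt (\<Sum>k<Suc n. (y k)\<^sup>2) \<le> (\<Sum>k<Suc n. g i k * y k)} \<le> M"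
  shows "card I * ((3/5 / (real n + 1) + 16/25 / (real n + 2)) * (4/5) ^ n) \<le> M * sqrt (2 * pi / (real n + 1))"
proof -
  let ?V = "unit_ball_vol n" and ?c = "3/5 / (real n + 1) * (4/5) ^ n + (4/5) ^ (n + 2) / (real n + 2)"
  define B :: "(nat \<Rightarrow> real) set" where
    "B = {f. sqrt (\<Sum>i<Suc n. (f i)\<^sup>2) \<le> 1} \<inter> space (lborel_pow (Suc n))"
  have B[measurable]: "B \<in> sets (lborel_pow (Suc n))"
  proof -
    have "B = {f \<in> space (lborel_pow (Suc n)). sqrt (\<Sum>i<Suc n. (f i)\<^sup>2) \<le> 1}" by (auto simp: B_def)
    then show ?thesis by simp
  qed
  have eB: "emeasure (lborel_pow (Suc n)) B = ennreal (unit_ball_vol (Suc n))"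
    unfolding B_def using emeasure_cball_aux[of "{..<Suc n}" 1] by simp
  have "ennreal (card I * (?V * ?c)) = (\<Sum>i\<in>I. ennreal (?V * ?c))"
    by (simp add: ennreal_mult' ennreal_of_nat_eq_real_of_nat)
  also have "\<dots> \<le> (\<Sum>i\<in>I. emeasure (lborel_pow (Suc n)) (unit_cap (Suc n) (g i)))"
    by (intro sum_mono emeasure_unit_cap unit)
  also have "\<dots> = (\<Sum>i\<in>I. \<integral>\<^sup>+y. indicator (unit_cap (Suc n) (g i)) y \<partial>lborel_pow (Suc n))"
    by simp
  also have "\<dots> = (\<integral>\<^sup>+y. (\<Sum>i\<in>I. indicator (unit_cap (Suc n) (g i)) y) \<partial>lborel_pow (Suc n))"
    by (rule nn_integral_sum[symmetric]) measurable
  also have "\<dots> \<le> (\<integral>\<^sup>+y. of_nat M * indicator B y \<partial>lborel_pow (Suc n))"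
  proof (intro nn_integral_mono)
    fix y :: "nat \<Rightarrow> real"
    show "(\<Sum>i\<in>I. indicator (unit_cap (Suc n) (g i)) y) \<le> (of_nat M * indicator B y :: ennreal)"
    proof (cases "y \<in> B \<and> 0 < (\<Sum>k<Suc n. (y k)\<^sup>2)")
      case True
      have "(\<Sum>i\<in>I. indicator (unit_cap (Suc n) (g i)) y :: ennreal) = of_nat (card {i\<in>I. y \<in> unit_cap (Suc n) (g i)})"
        using I by (simp add: indicator_def sum.If_cases Int_def)
      also have "card {i\<in>I. y \<in> unit_cap (Suc n) (g i)} \<le> card {i \<in> I. 3/5 * sqrt (\<Sum>k<Suc n. (y k)\<^sup>2) \<le> (\<Sum>k<Suc n. g i k * y k)}"
        using I by (intro card_mono) (auto simp: unit_cap_def)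
      also have "\<dots> \<le> M" using True by (intro cap) simp
      finally show ?thesis using True by simp
    next
      case False
      then have "y \<notin> unit_cap (Suc n) (g i)" for i
        unfolding unit_cap_def B_def by (auto simp del: sum.lessThan_Suc)
      then show ?thesis by simp
    qed
  qed
  also have "\<dots> = ennreal (M * unit_ball_vol (Suc n))"
    by (subst nn_integral_cmult_indicator) (auto simp: eB ennreal_mult' ennreal_of_nat_eq_real_of_nat)
  finally have "card I * (?V * ?c) \<le> M * unit_ball_vol (Suc n)"
    by (subst (asm) ennreal_le_iff) auto
  also have "\<dots> \<le> M * (sqrt (2 * pi / (Suc n)) * ?V)"
    by (intro mult_left_mono unit_ball_vol_Suc_le) auto
  finally have "(card I * ?c) * ?V \<le> (M * sqrt (2 * pi / (real n + 1))) * ?V" by (simp add: mult_ac add_ac)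
  moreover have "?V > 0" by simp
  ultimately have "card I * ?c \<le> M * sqrt (2 * pi / (real n + 1))" by (rule mult_right_le_imp_le)
  moreover have "?c = (3/5 / (real n + 1) + 16/25 / (real n + 2)) * (4/5) ^ n"
    by (simp add: distrib_right power_add power2_eq_square)
  ultimately show ?thesis by simp
qed

section \<open>Minimal counterexamples\<close>

text \<open>With a vertex set and a relation, induced subgraphs are mere subsets \<open>T\<close>,
  and \<open>smaller\<close> states minimality for these only; reducedness is relative to
  \<open>T\<close>.\<close>

locale minimal_counterexample =
  fixes V :: "'a set" and E :: "'a \<Rightarrow> 'a \<Rightarrow> bool" and r :: nat
  fixes A :: "'a \<Rightarrow> 'a \<Rightarrow> real" and rk :: "'a set \<Rightarrow> nat"
  defines "A \<equiv> \<lambda>u v. of_bool (E u v)" and "rk \<equiv> \<lambda>T. set_matrix_rank T A"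
  assumes finite_V: "finite V"
    and E_sym: "E u v \<longleftrightarrow> E v u"
    and E_irrefl: "\<not> E u u"
    and no_isolated: "u \<in> V \<Longrightarrow> \<exists>v\<in>V. E u v"
    and no_twins: "u \<in> V \<Longrightarrow> v \<in> V \<Longrightarrow> u \<noteq> v \<Longrightarrow> \<exists>w\<in>V. E u w \<noteq> E v w"
    and rk_V: "rk V = r"
    and r_ge: "47 \<le> r"
    and order_gt: "max_order r < card V"
    and smaller: "T \<subseteq> V \<Longrightarrow> 2 \<le> rk T \<Longrightarrow> rk T < r \<Longrightarrow> (\<And>u. u \<in> T \<Longrightarrow> \<exists>v\<in>T. E u v) \<Longrightarrow>
      (\<And>u v. u \<in> T \<Longrightarrow> v \<in> T \<Longrightarrow> u \<noteq> v \<Longrightarrow> \<exists>w\<in>T. E u w \<noteq> E v w) \<Longrightarrow> card T \<le> max_order (rk T)"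
begin

abbreviation twins :: "'a set \<Rightarrow> 'a \<Rightarrow> 'a \<Rightarrow> bool" where
  "twins T u v \<equiv> \<forall>w\<in>T. E u w = E v w"

definition diff :: "'a \<Rightarrow> 'a \<Rightarrow> 'a set" where
  "diff u v = {w \<in> V. E u w \<noteq> E v w}"

lemma A_sym: "A u v = A v u"
  by (simp add: A_def E_sym)

lemma A_eq_iff: "A u t = A v s \<longleftrightarrow> (E u t \<longleftrightarrow> E v s)"
  by (auto simp: A_def)

lemma finite_sub: "T \<subseteq> V \<Longrightarrow> finite T"
  using finite_V by (rule rev_finite_subset)

lemma diff_subset: "diff u v \<subseteq> V"
  by (auto simp: diff_def)

lemma finite_diff' [simp]: "finite (diff u v)"
  using diff_subset by (rule finite_sub)

lemma rk_mono: "S \<subseteq> T \<Longrightarrow> T \<subseteq> V \<Longrightarrow> rk S \<le> rk T"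
  unfolding rk_def by (intro set_matrix_rank_mono) (auto intro: finite_sub)

lemma rk_le: "T \<subseteq> V \<Longrightarrow> rk T \<le> r"
  using rk_mono[of T V] rk_V by simp

lemma rk_insert:
  assumes "T \<subseteq> V" "y \<in> V" "y \<notin> T"
    "\<And>t. t \<in> T \<Longrightarrow> (\<Sum>w\<in>T. z w * A w t) = 0" "(\<Sum>w\<in>T. z w * A w y) \<noteq> 0"
  shows "rk T + 2 \<le> rk (insert y T)"
  unfolding rk_def using assms finite_sub A_sym by (intro set_matrix_rank_insert_ge[where z = z]) auto

lemma sum_indicator_row: "finite T \<Longrightarrow> u \<in> T \<Longrightarrow> (\<Sum>w\<in>T. of_bool (w = u) * A w t) = A u t"
  by (simp add: of_bool_def if_distrib[of "\<lambda>c. c * _"] sum.delta cong: if_cong)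

lemma sum_indicator_diff:
  "finite T \<Longrightarrow> u \<in> T \<Longrightarrow> v \<in> T \<Longrightarrow>
    (\<Sum>w\<in>T. (of_bool (w = u) - of_bool (w = v)) * A w t) = A u t - A v t"
  by (simp add: left_diff_distrib sum_subtractf sum_indicator_row)

lemma rk_edge:
  assumes "u \<in> T" "v \<in> T" "E u v" "T \<subseteq> V"
  shows "2 \<le> rk T"
proof -
  have "rk {u} + 2 \<le> rk (insert v {u})"
    using assms E_irrefl by (intro rk_insert[where z = "\<lambda>_. 1"]) (auto simp: A_def)
  also have "\<dots> \<le> rk T" using assms by (intro rk_mono) auto
  finally show ?thesis by simp
qed

text \<open>The difference of the unit vectors at the twins is a kernel vector of the submatrix on
  \<open>T\<close>; reducedness gives a vertex \<open>y\<close> outside \<open>T\<close> that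
  detects it.\<close>

lemma rk_twins:
  assumes "T \<subseteq> V" "u \<in> T" "v \<in> T" "u \<noteq> v" "twins T u v"
  shows "rk T + 2 \<le> r"
proof -
  obtain y where y: "y \<in> V" "E u y \<noteq> E v y" using no_twins[of u v] assms by blast
  then have "y \<notin> T" using assms by blast
  have "rk T + 2 \<le> rk (insert y T)"
    using assms y \<open>y \<notin> T\<close> finite_sub[OF assms(1)]
    by (intro rk_insert[where z = "\<lambda>w. of_bool (w = u) - of_bool (w = v)"])
       (auto simp: sum_indicator_diff A_eq_iff)
  also have "\<dots> \<le> r" using assms y by (intro rk_le) auto
  finally show ?thesis .
qed

text \<open>Adding \<open>x\<close> raises the rank by two. A combination of the two kernel vectors
  also kills column \<open>x\<close>, so it is a kernel vector on \<open>insert x T\<close>; the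
  determinant says that column \<open>y\<close> detects it, giving two more.\<close>

lemma rk_two_kernel_vectors_aux:
  assumes T: "T \<subseteq> V" and x: "x \<in> V - T" and y: "y \<in> V - T" and "x \<noteq> y"
    and zp: "\<And>t. t \<in> T \<Longrightarrow> (\<Sum>w\<in>T. zp w * A w t) = 0"
    and zq: "\<And>t. t \<in> T \<Longrightarrow> (\<Sum>w\<in>T. zq w * A w t) = 0"
    and zpx: "(\<Sum>w\<in>T. zp w * A w x) \<noteq> 0"
    and det: "(\<Sum>w\<in>T. zp w * A w x) * (\<Sum>w\<in>T. zq w * A w y) \<noteq> (\<Sum>w\<in>T. zp w * A w y) * (\<Sum>w\<in>T. zq w * A w x)"
  shows "rk T + 4 \<le> r"
proof -
  define b1 b2 where "b1 = (\<lambda>t. \<Sum>w\<in>T. zp w * A w t)" and "b2 = (\<lambda>t. \<Sum>w\<in>T. zq w * A w t)"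
  have finT: "finite T" by (rule finite_sub[OF T])
  define z where "z = (\<lambda>w. if w = x then 0 else b1 x * zq w - b2 x * zp w)"
  have z: "(\<Sum>w\<in>insert x T. z w * A w t) = b1 x * b2 t - b2 x * b1 t" for t
  proof -
    have "(\<Sum>w\<in>insert x T. z w * A w t) = (\<Sum>w\<in>T. z w * A w t)" using finT x by (simp add: z_def)
    also have "\<dots> = (\<Sum>w\<in>T. (b1 x * zq w - b2 x * zp w) * A w t)"
      using x by (intro sum.cong) (auto simp: z_def)
    also have "\<dots> = b1 x * (\<Sum>w\<in>T. zq w * A w t) - b2 x * (\<Sum>w\<in>T. zp w * A w t)"
      by (simp add: algebra_simps sum_subtractf sum_distrib_left)
    also have "\<dots> = b1 x * b2 t - b2 x * b1 t" by (simp only: b1_def b2_def)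
    finally show ?thesis .
  qed
  have "rk T + 2 \<le> rk (insert x T)" using T x zp zpx by (intro rk_insert) auto
  moreover have "rk (insert x T) + 2 \<le> rk (insert y (insert x T))"
  proof (rule rk_insert[where z = z])
    show "(\<Sum>w\<in>insert x T. z w * A w t) = 0" if "t \<in> insert x T" for t
      unfolding z using that zp[of t] zq[of t] by (auto simp: b1_def b2_def)
    show "(\<Sum>w\<in>insert x T. z w * A w y) \<noteq> 0"
      unfolding z using det by (simp add: b1_def b2_def mult.commute)
  qed (use assms in auto)
  moreover have "rk (insert y (insert x T)) \<le> r" using assms by (intro rk_le) auto
  ultimately show ?thesis by linarith
qed

lemma rk_two_kernel_vectors:
  assumes T: "T \<subseteq> V" and x: "x \<in> V - T" and y: "y \<in> V - T" and "x \<noteq> y"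
    and zp: "\<And>t. t \<in> T \<Longrightarrow> (\<Sum>w\<in>T. zp w * A w t) = 0"
    and zq: "\<And>t. t \<in> T \<Longrightarrow> (\<Sum>w\<in>T. zq w * A w t) = 0"
    and det: "(\<Sum>w\<in>T. zp w * A w x) * (\<Sum>w\<in>T. zq w * A w y) \<noteq> (\<Sum>w\<in>T. zp w * A w y) * (\<Sum>w\<in>T. zq w * A w x)"
  shows "rk T + 4 \<le> r"
proof (cases "(\<Sum>w\<in>T. zp w * A w x) = 0")
  case False
  then show ?thesis using assms by (intro rk_two_kernel_vectors_aux[of T x y zp zq])
next
  case True
  with det have "(\<Sum>w\<in>T. zq w * A w x) \<noteq> 0" by auto
  then show ?thesis using assms by (intro rk_two_kernel_vectors_aux[of T x y zq zp]) (auto simp: mult.commute)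
qed

text \<open>Vertices agreeing on \<open>T\<close> are told apart by their adjacencies to a
  determining set of at most r - rk T vertices. They need not belong to \<open>T\<close>, unlike in
  \<open>rk_twins\<close>.\<close>

lemma card_agreeing:
  assumes X: "X \<subseteq> V" and T: "T \<subseteq> V" and agree: "\<And>x y. x \<in> X \<Longrightarrow> y \<in> X \<Longrightarrow> twins T x y"
  shows "card X \<le> 2 ^ (r - rk T)"
proof -
  obtain J where J: "J \<subseteq> V" "card J + rk T \<le> rk V"
    "\<And>z v. (\<And>t. t \<in> T \<union> J \<Longrightarrow> (\<Sum>w\<in>V. z w * A w t) = 0) \<Longrightarrow> v \<in> V \<Longrightarrow> (\<Sum>w\<in>V. z w * A w v) = 0"
    unfolding rk_def by (rule determining_columns[OF finite_V T, of A]) (use A_sym in blast)+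
  have inj: "inj_on (\<lambda>x. {j \<in> J. E x j}) X"
  proof (rule inj_onI, rule ccontr)
    fix x y assume xy: "x \<in> X" "y \<in> X" "{j \<in> J. E x j} = {j \<in> J. E y j}" "x \<noteq> y"
    have xyV: "x \<in> V" "y \<in> V" using xy X by auto
    obtain v where v: "v \<in> V" "E x v \<noteq> E y v" using no_twins[OF xyV] xy by blast
    have "(\<Sum>w\<in>V. (of_bool (w = x) - of_bool (w = y)) * A w v) = 0"
    proof (rule J(3)[OF _ v(1)])
      fix t assume "t \<in> T \<union> J"
      then have "E x t = E y t" using agree xy by blast
      then show "(\<Sum>w\<in>V. (of_bool (w = x) - of_bool (w = y)) * A w t) = 0"
        using xyV finite_V by (simp add: sum_indicator_diff A_eq_iff)
    qed
    then show False using v xyV finite_V by (simp add: sum_indicator_diff A_eq_iff)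
  qed
  have finJ: "finite J" using J(1) by (rule finite_sub)
  have "card X = card ((\<lambda>x. {j \<in> J. E x j}) ` X)" using inj by (simp add: card_image)
  also have "\<dots> \<le> card (Pow J)" using finJ by (intro card_mono) auto
  also have "\<dots> = 2 ^ card J" using finJ by (rule card_Pow)
  also have "\<dots> \<le> 2 ^ (r - rk T)" using J(2) rk_V by (intro power_increasing) auto
  finally show ?thesis .
qed

text \<open>At full rank the determining set \<open>J\<close> is empty, so a relation vanishing on
  \<open>T\<close> would vanish everywhere.\<close>

lemma rk_less_if_relation:
  assumes T: "T \<subseteq> V" and z: "\<And>t. t \<in> T \<Longrightarrow> (\<Sum>w\<in>V. z w * A w t) = 0"
    and v: "v \<in> V" "(\<Sum>w\<in>V. z w * A w v) \<noteq> 0"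
  shows "rk T < r"
proof (rule ccontr)
  assume "\<not> rk T < r"
  obtain J where J: "J \<subseteq> V" "card J + rk T \<le> rk V"
    "\<And>z v. (\<And>t. t \<in> T \<union> J \<Longrightarrow> (\<Sum>w\<in>V. z w * A w t) = 0) \<Longrightarrow> v \<in> V \<Longrightarrow> (\<Sum>w\<in>V. z w * A w v) = 0"
    unfolding rk_def by (rule determining_columns[OF finite_V T, of A]) (use A_sym in blast)+
  have "card J = 0" using J(2) rk_V \<open>\<not> rk T < r\<close> by linarith
  then have "J = {}" using finite_sub[OF J(1)] by simp
  then show False using J(3)[of z v] z v by auto
qed

text \<open>A largest extension \<open>S\<close> of \<open>Q\<close> by pairwise non-twin,
  non-isolated vertices of \<open>T\<close> represents every twin class of non-isolated vertices.
  Neighbours and separating vertices found in \<open>T\<close> can therefore be replaced by ones in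
  \<open>S\<close>, so \<open>S\<close> induces a reduced graph and minimality applies.\<close>

lemma card_nontwins_connected:
  assumes T: "T \<subseteq> V" and \<rho>: "rk T \<le> \<rho>" "\<rho> < r" and Q: "Q \<subseteq> T"
    and conn: "\<And>u. u \<in> Q \<Longrightarrow> \<exists>w\<in>T. E u w"
    and nt: "\<And>u v. u \<in> Q \<Longrightarrow> v \<in> Q \<Longrightarrow> u \<noteq> v \<Longrightarrow> \<not> twins T u v"
  shows "card Q \<le> max_order \<rho>"
proof -
  define good where "good = (\<lambda>S. Q \<subseteq> S \<and> S \<subseteq> T \<and> (\<forall>u\<in>S. \<exists>w\<in>T. E u w) \<and>
    (\<forall>u\<in>S. \<forall>v\<in>S. u \<noteq> v \<longrightarrow> \<not> twins T u v))"
  have finT: "finite T" by (rule finite_sub[OF T])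
  have "good Q" using Q conn nt unfolding good_def by blast
  moreover have "\<forall>S. good S \<longrightarrow> card S < Suc (card T)"
    using card_mono[OF finT] by (auto simp: good_def less_Suc_eq_le)
  ultimately obtain S where S: "good S" "\<And>S'. good S' \<Longrightarrow> card S' \<le> card S"
    using ex_has_greatest_nat[of good Q card "Suc (card T)"] by blast
  have finS: "finite S" using S(1) finT by (auto simp: good_def intro: finite_subset)
  have rep: "\<exists>q\<in>S. twins T t q" if t: "t \<in> T" "w \<in> T" "E t w" for t w
  proof (rule ccontr)
    assume n: "\<not> (\<exists>q\<in>S. twins T t q)"
    then have "t \<notin> S" by blast
    have "good (insert t S)"
    proof -
      have "\<not> twins T u v" if "u \<in> insert t S" "v \<in> insert t S" "u \<noteq> v" for u v
      proof (cases "u = t"; cases "v = t")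
        assume "u \<noteq> t" "v = t"
        then have "u \<in> S" using that by simp
        then have "\<not> twins T t u" using n by blast
        then show ?thesis using \<open>v = t\<close> by blast
      next
        assume "u = t" "v \<noteq> t"
        then have "v \<in> S" using that by simp
        then show ?thesis using n \<open>u = t\<close> by blast
      next
        assume "u \<noteq> t" "v \<noteq> t"
        then have "u \<in> S" "v \<in> S" using that by auto
        then show ?thesis using S(1) that(3) unfolding good_def by blast
      qed (use that in auto)
      moreover have "\<exists>w\<in>T. E u w" if "u \<in> insert t S" for u
      proof (cases "u = t")
        case True
        then show ?thesis using t by blast
      next
        case False
        then have "u \<in> S" using that by simp
        then show ?thesis using S(1) by (simp add: good_def)
      qed
      moreover have "Q \<subseteq> insert t S" "insert t S \<subseteq> T" using S(1) t(1) by (auto simp: good_def)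
      ultimately show ?thesis unfolding good_def by metis
    qed
    from S(2)[OF this] show False using finS \<open>t \<notin> S\<close> by simp
  qed
  have S': "S \<subseteq> T" "\<And>u. u \<in> S \<Longrightarrow> \<exists>w\<in>T. E u w" "\<And>u v. u \<in> S \<Longrightarrow> v \<in> S \<Longrightarrow> u \<noteq> v \<Longrightarrow> \<not> twins T u v" "Q \<subseteq> S"
    using S(1) by (simp_all add: good_def)
  have "card S \<le> max_order \<rho>"
  proof (cases "S = {}")
    case False
    have c: "\<exists>v\<in>S. E u v" if u: "u \<in> S" for u
    proof -
      obtain w where w: "w \<in> T" "E u w" using S'(2)[OF u] by blast
      have uT: "u \<in> T" using u S'(1) by blast
      obtain q where q: "q \<in> S" "twins T w q" using rep[OF w(1) uT] w(2) E_sym[of w u] by blast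
      then have "E q u" using w(2) uT E_sym[of w u] by simp
      then show ?thesis using q(1) E_sym[of u q] by blast
    qed
    have d: "\<exists>q\<in>S. E u q \<noteq> E v q" if uv: "u \<in> S" "v \<in> S" "u \<noteq> v" for u v
    proof -
      obtain w where w: "w \<in> T" "E u w \<noteq> E v w" using S'(3)[OF uv] by blast
      have uvT: "u \<in> T" "v \<in> T" using uv S'(1) by auto
      have "E w u \<or> E w v" using w(2) E_sym[of w u] E_sym[of w v] by blast
      then obtain q where q: "q \<in> S" "twins T w q" using rep[OF w(1)] uvT by blast
      then have "E w u = E q u" "E w v = E q v" using uvT by auto
      then have "E u q \<noteq> E v q"
        using w(2) E_sym[of w u] E_sym[of w v] E_sym[of q u] E_sym[of q v] by simp
      then show ?thesis using q(1) by blast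
    qed
    obtain u v where "u \<in> S" "v \<in> S" "E u v" using False c by blast
    then have 2: "2 \<le> rk S" using S'(1) T by (intro rk_edge[of u S v]) auto
    have "rk S \<le> \<rho>" using rk_mono[OF S'(1) T] \<rho>(1) by simp
    moreover have "card S \<le> max_order (rk S)"
      using S'(1) T 2 \<open>rk S \<le> \<rho>\<close> \<rho>(2) c d by (intro smaller) auto
    ultimately show ?thesis using max_order_mono[OF 2, of \<rho>] by linarith
  qed simp
  then show ?thesis using card_mono[OF finS S'(4)] by linarith
qed

text \<open>Vertices isolated in \<open>T\<close> are twins of each other, so at most one of them
  lies in \<open>Q\<close>; it accounts for the summand 1.\<close>

lemma card_nontwins:
  assumes T: "T \<subseteq> V" and \<rho>: "rk T \<le> \<rho>" "\<rho> < r" and Q: "Q \<subseteq> T"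
    and nt: "\<And>u v. u \<in> Q \<Longrightarrow> v \<in> Q \<Longrightarrow> u \<noteq> v \<Longrightarrow> \<not> twins T u v"
  shows "card Q \<le> max_order \<rho> + 1"
proof -
  define I where "I = {u \<in> Q. \<forall>w\<in>T. \<not> E u w}"
  have finQ: "finite Q" using Q T finite_sub by blast
  have "\<exists>a. I \<subseteq> {a}" 
  proof (cases "I = {}")
    case False
    then obtain a where a: "a \<in> I" by blast
    have "b = a" if "b \<in> I" for b
      using nt[of a b] a that unfolding I_def by blast
    then show ?thesis by blast
  qed simp
  then obtain a where "I \<subseteq> {a}" by blast
  from card_mono[OF _ this] have "card I \<le> 1" by simp
  moreover have "card (Q - I) \<le> max_order \<rho>"
    by (rule card_nontwins_connected[OF T \<rho>]) (use Q nt in \<open>auto simp: I_def\<close>)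
  moreover have "card Q = card (Q - I) + card I"
    using finQ by (subst card_Un_disjoint[symmetric]) (auto simp: I_def intro: arg_cong[where f = card])
  ultimately show ?thesis by linarith
qed

lemma order_step_2: "2 * max_order (r - 2) + 2 = max_order r"
  and order_step_4: "2 * max_order (r - 4) + 2 = max_order (r - 2)"
  and order_step_16: "256 * max_order (r - 16) + 510 = max_order r"
  and order_step_1: "5 * max_order (r - 1) + 2 \<le> 4 * max_order r"
  and order_large: "20971518 \<le> max_order r"
proof -
  have e: "r - 2 + 2 = r" "r - 4 + 2 = r - 2" "r - 16 + 2 * 8 = r" "Suc (r - 1) = r" using r_ge by auto
  have g: "2 \<le> r - 2" "2 \<le> r - 4" "2 \<le> r - 16" "2 \<le> r - 1" using r_ge by auto
  show "2 * max_order (r - 2) + 2 = max_order r" using max_order_add_2[OF g(1)] unfolding e by simp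
  show "2 * max_order (r - 4) + 2 = max_order (r - 2)" using max_order_add_2[OF g(2)] unfolding e by simp
  show "256 * max_order (r - 16) + 510 = max_order r"
    using max_order_add_double[OF g(3), of 8] unfolding e by simp
  show "5 * max_order (r - 1) + 2 \<le> 4 * max_order r"
    using max_order_Suc[OF g(4)] unfolding e by simp
  show "20971518 \<le> max_order r" using max_order_mono[OF _ r_ge] max_order_47 by simp
qed

end

section \<open>Non-adjacent vertices are far apart\<close>

text \<open>\<open>close\<close> negates the distance claim for a closest pair, and
  \<open>x0\<close> breaks the symmetry between \<open>u\<close> and \<open>v\<close> and names the
  two sides.\<close>

locale close_nonadjacent_pair = minimal_counterexample +
  fixes u v x0 :: 'a
  assumes uV: "u \<in> V" and vV: "v \<in> V" and uv: "u \<noteq> v" and nadj: "\<not> E u v"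
    and closest: "\<And>a b. a \<in> V \<Longrightarrow> b \<in> V \<Longrightarrow> a \<noteq> b \<Longrightarrow> \<not> E a b \<Longrightarrow> card (diff u v) \<le> card (diff a b)"
    and close: "256 * card (diff u v) < 127 * card V"
    and x0: "x0 \<in> V" "E u x0" "\<not> E v x0"
begin

text \<open>
  The twin classes of \<open>H\<close> have one or two elements: \<open>P\<close> consists of the classes of size two, each of
  which has one element in \<open>U\<close> and one in \<open>W\<close>, and \<open>S\<close> of the classes of size one.
\<close>

definition X where "X = diff u v"
definition H where "H = V - X"
definition P where "P = {a \<in> H. \<exists>b\<in>H. b \<noteq> a \<and> twins H a b}"
definition S where "S = H - P"
definition U where "U = {a \<in> P. E a x0}"
definition W where "W = {a \<in> P. \<not> E a x0}"

section \<open>Twin pairs and single vertices after deleting the difference set\<close>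

lemma XV: "X \<subseteq> V" and HV: "H \<subseteq> V" and PH: "P \<subseteq> H" and SH: "S \<subseteq> H"
  by (auto simp: X_def diff_def H_def P_def S_def)

lemma fin: "finite X" "finite H" "finite P" "finite S" "finite U" "finite W"
  using finite_sub[OF XV] finite_sub[OF HV] PH SH by (auto simp: U_def W_def intro: finite_subset)

lemma X_iff: "x \<in> X \<Longrightarrow> E v x \<longleftrightarrow> \<not> E u x"
  by (auto simp: X_def diff_def)

lemma H_iff: "x \<in> H \<Longrightarrow> E v x \<longleftrightarrow> E u x"
  by (auto simp: H_def X_def diff_def)

lemma x0X: "x0 \<in> X" using x0 by (simp add: X_def diff_def)

lemma uH: "u \<in> H" and vH: "v \<in> H"
  using uV vV nadj E_sym[of u v] E_irrefl by (auto simp: H_def X_def diff_def)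

lemma rk_H: "rk H + 2 \<le> r"
  using H_iff by (intro rk_twins[OF HV uH vH uv]) auto

text \<open>Twins in \<open>H\<close> are non-adjacent and can differ only on \<open>X\<close>, and
  no such pair is closer than card X. So twins are complementary on all of \<open>X\<close>, which
  three vertices cannot be pairwise; this limits twin classes to two elements.\<close>

lemma twins_diff:
  assumes "a \<in> H" "b \<in> H" "a \<noteq> b" "twins H a b"
  shows "diff a b = X"
proof -
  have "\<not> E a b" using assms E_irrefl[of b] by auto
  then have "card X \<le> card (diff a b)" unfolding X_def using assms HV by (intro closest) auto
  moreover have "diff a b \<subseteq> X" using assms by (auto simp: diff_def H_def)
  ultimately show ?thesis using fin(1) by (intro card_seteq) auto
qed

lemma twins_X:
  assumes "a \<in> H" "b \<in> H" "a \<noteq> b" "twins H a b" "x \<in> X"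
  shows "E b x \<longleftrightarrow> \<not> E a x"
  using twins_diff[OF assms(1-4)] assms(5) by (auto simp: diff_def)

lemma U_nontwins: "a \<in> U \<Longrightarrow> b \<in> U \<Longrightarrow> a \<noteq> b \<Longrightarrow> \<not> twins H a b"
  and W_nontwins: "a \<in> W \<Longrightarrow> b \<in> W \<Longrightarrow> a \<noteq> b \<Longrightarrow> \<not> twins H a b"
  using twins_X[OF _ _ _ _ x0X, of a b] PH by (auto simp: U_def W_def)

lemma partner:
  assumes "a \<in> P"
  shows "\<exists>b. b \<in> P \<and> b \<noteq> a \<and> twins H a b \<and> (\<forall>x\<in>X. E b x \<longleftrightarrow> \<not> E a x)"
proof -
  from assms obtain b where b: "b \<in> H" "b \<noteq> a" "twins H a b" and a: "a \<in> H"
    unfolding P_def mem_Collect_eq by (elim conjE bexE) (rule that)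
  have "twins H b a" using b(3) by simp
  then have "b \<in> P" using a b(1,2) unfolding P_def mem_Collect_eq by (intro conjI bexI[of _ a]) simp_all
  moreover have "\<forall>x\<in>X. E b x \<longleftrightarrow> \<not> E a x" using twins_X[OF a b(1) _ b(3)] b(2) by simp
  ultimately show ?thesis using b(2,3) by (intro exI[of _ b] conjI)
qed

text \<open>Passing to the partner flips adjacency to \<open>x0\<close>, hence exchanges the sides;
  two vertices with one partner would be twins on the same side.\<close>

lemma card_UW: "card U = card W"
proof -
  define f where "f = (\<lambda>a. SOME b. b \<in> P \<and> b \<noteq> a \<and> twins H a b \<and> (\<forall>x\<in>X. E b x \<longleftrightarrow> \<not> E a x))"
  have f: "f a \<in> P \<and> f a \<noteq> a \<and> twins H a (f a) \<and> (\<forall>x\<in>X. E (f a) x \<longleftrightarrow> \<not> E a x)" if aP: "a \<in> P" for a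
    unfolding f_def by (rule someI_ex[OF partner[OF aP]])
  have tr: "twins H a b" if "f a = f b" "a \<in> P" "b \<in> P" for a b
    using f[OF that(2)] f[OF that(3)] that(1) by simp
  have UP: "U \<subseteq> P" "W \<subseteq> P" by (auto simp: U_def W_def)
  have "inj_on f U"
  proof (rule inj_onI, rule ccontr)
    fix a b assume ab: "a \<in> U" "b \<in> U" "f a = f b" "a \<noteq> b"
    show False using U_nontwins[OF ab(1,2,4)] tr[OF ab(3)] ab(1,2) UP by (simp add: subset_iff)
  qed
  moreover have "f ` U \<subseteq> W" using f x0X by (auto simp: U_def W_def)
  ultimately have 1: "card U \<le> card W" using fin by (intro card_inj_on_le)
  have "inj_on f W"
  proof (rule inj_onI, rule ccontr)
    fix a b assume ab: "a \<in> W" "b \<in> W" "f a = f b" "a \<noteq> b"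
    show False using W_nontwins[OF ab(1,2,4)] tr[OF ab(3)] ab(1,2) UP by (simp add: subset_iff)
  qed
  moreover have "f ` W \<subseteq> U" using f x0X by (auto simp: U_def W_def)
  ultimately have "card W \<le> card U" using fin by (intro card_inj_on_le)
  with 1 show ?thesis by simp
qed

lemma card_P: "card P = 2 * card U"
proof -
  have "card (U \<union> W) = card U + card W" using fin by (intro card_Un_disjoint) (auto simp: U_def W_def)
  moreover have "U \<union> W = P" by (auto simp: U_def W_def)
  ultimately show ?thesis using card_UW by simp
qed

lemma card_V: "card V = card X + 2 * card U + card S"
proof -
  have "card V = card X + card H"
    using card_Un_disjoint[of X H] fin XV by (auto simp: H_def Un_absorb1)
  moreover have "card H = card P + card S"
    using card_Un_disjoint[of P S] fin PH by (auto simp: S_def Un_absorb1)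
  ultimately show ?thesis using card_P by simp
qed

lemma nontwins_US: "a \<in> U \<union> S \<Longrightarrow> b \<in> U \<union> S \<Longrightarrow> a \<noteq> b \<Longrightarrow> \<not> twins H a b"
proof
  assume ab: "a \<in> U \<union> S" "b \<in> U \<union> S" "a \<noteq> b" "twins H a b"
  have UH: "U \<subseteq> H" using PH by (auto simp: U_def)
  have "a \<in> H" "b \<in> H" using ab UH SH by auto
  then have "a \<in> P" "b \<in> P" using ab by (auto simp: P_def)
  then have "a \<in> U" "b \<in> U" using ab by (auto simp: S_def)
  then show False using U_nontwins ab by blast
qed

lemma card_US: "card (U \<union> S) = card U + card S"
  using fin by (intro card_Un_disjoint) (auto simp: U_def S_def)

lemma US_H: "U \<union> S \<subseteq> H" using PH SH by (auto simp: U_def)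

lemma pairs_singles: "rk H \<le> \<rho> \<Longrightarrow> \<rho> < r \<Longrightarrow> card U + card S \<le> max_order \<rho> + 1"
  using card_nontwins[OF HV _ _ US_H nontwins_US] card_US by simp

lemma pairs_singles_2: "2 * card U + 2 * card S \<le> max_order r"
proof -
  have "card U + card S \<le> max_order (r - 2) + 1" using rk_H r_ge by (intro pairs_singles) auto
  then show ?thesis using order_step_2 by linarith
qed

lemma card_S: "card S < card X"
  using pairs_singles_2 card_V order_gt by linarith

text \<open>Since card S < card X, n - 2 card X < 2 card U; closeness makes the left side larger
  than n/128.\<close>

lemma card_U: "card V < 256 * card U"
  using pairs_singles_2 card_V order_gt close unfolding X_def[symmetric] by linarith

text \<open>After a drop of four, U and S together would have fewer than n/4 elements, so
  \<open>X\<close> would have more than n/2.\<close>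

lemma rk_H': "r < rk H + 4"
proof (rule ccontr)
  assume "\<not> r < rk H + 4"
  then have "card U + card S \<le> max_order (r - 4) + 1" using r_ge by (intro pairs_singles) auto
  then show False
    using order_step_2 order_step_4 card_V order_gt close unfolding X_def[symmetric] by linarith
qed

text \<open>Each twin pair gives a kernel vector on \<open>H\<close>. If its values at
  \<open>x0\<close> and \<open>x\<close> were not proportional to those from \<open>u\<close> and
  \<open>v\<close>, the rank would drop by four. So all twin pairs look like u, v on
  \<open>X\<close>.\<close>

lemma U_pattern:
  assumes a: "a \<in> U" and x: "x \<in> X"
  shows "E a x \<longleftrightarrow> E u x"
proof (rule ccontr)
  assume n: "E a x \<noteq> E u x"
  have aP: "a \<in> P" "E a x0" using a by (auto simp: U_def)
  from partner[OF aP(1)] obtain b where b: "b \<in> P" "b \<noteq> a" "twins H a b" "\<forall>x\<in>X. E b x \<longleftrightarrow> \<not> E a x"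
    by (elim exE conjE) (rule that)
  have abH: "a \<in> H" "b \<in> H" using aP b PH by auto
  have "x \<noteq> x0" using n aP x0 by auto
  have "rk H + 4 \<le> r"
  proof (rule rk_two_kernel_vectors[OF HV, where zp = "\<lambda>w. of_bool (w = u) - of_bool (w = v)"
        and zq = "\<lambda>w. of_bool (w = a) - of_bool (w = b)"])
    show "x0 \<in> V - H" "x \<in> V - H" using x0X x XV by (auto simp: H_def)
    show "x0 \<noteq> x" using \<open>x \<noteq> x0\<close> by simp
    show "(\<Sum>w\<in>H. (of_bool (w = u) - of_bool (w = v)) * A w t) = 0" if "t \<in> H" for t
      using that H_iff[OF that] by (simp add: sum_indicator_diff fin uH vH A_eq_iff)
    show "(\<Sum>w\<in>H. (of_bool (w = a) - of_bool (w = b)) * A w t) = 0" if "t \<in> H" for t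
      using that b(3) by (simp add: sum_indicator_diff fin abH A_eq_iff)
    show "(\<Sum>w\<in>H. (of_bool (w = u) - of_bool (w = v)) * A w x0) * (\<Sum>w\<in>H. (of_bool (w = a) - of_bool (w = b)) * A w x) \<noteq>
      (\<Sum>w\<in>H. (of_bool (w = u) - of_bool (w = v)) * A w x) * (\<Sum>w\<in>H. (of_bool (w = a) - of_bool (w = b)) * A w x0)"
      using n x0 aP(2) bspec[OF b(4) x] bspec[OF b(4) x0X] X_iff[OF x]
      unfolding sum_indicator_diff[OF fin(2) uH vH] sum_indicator_diff[OF fin(2) abH]
      by (auto simp: A_def)
  qed
  then show False using rk_H' by simp
qed

lemma W_pattern:
  assumes a: "a \<in> W" and x: "x \<in> X"
  shows "E a x \<longleftrightarrow> \<not> E u x"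
proof -
  have aP: "a \<in> P" "\<not> E a x0" using a by (auto simp: W_def)
  from partner[OF aP(1)] obtain b where b: "b \<in> P" "b \<noteq> a" "twins H a b" "\<forall>x\<in>X. E b x \<longleftrightarrow> \<not> E a x"
    by (elim exE conjE) (rule that)
  then have "b \<in> U" using aP x0X by (auto simp: U_def)
  then show ?thesis using U_pattern[OF _ x] bspec[OF b(4) x] by blast
qed

lemma P_cases: "a \<in> P \<Longrightarrow> a \<in> U \<or> a \<in> W"
  by (auto simp: U_def W_def)

text \<open>Twins on \<open>T\<close> that agree on \<open>X\<close> would differ only inside
  \<open>S\<close>, which is smaller than \<open>X\<close>, against the minimality of card
  X.\<close>

lemma nontwins_same_side:
  assumes T: "P \<subseteq> T" "T \<subseteq> V" and ab: "a \<in> P" "b \<in> P" "a \<noteq> b" and same: "\<And>x. x \<in> X \<Longrightarrow> E a x = E b x"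
  shows "\<not> twins T a b"
proof
  assume tw: "twins T a b"
  have abT: "a \<in> V" "b \<in> V" "b \<in> T" using ab T by auto
  have "\<not> E a b" using tw abT E_irrefl[of b] by auto
  then have "card X \<le> card (diff a b)" unfolding X_def using ab abT by (intro closest) auto
  also have "diff a b \<subseteq> S"
    using tw same T(1) by (auto simp: diff_def S_def H_def)
  then have "card (diff a b) \<le> card S" using fin by (intro card_mono)
  finally show False using card_S by simp
qed

lemma U_nontwins_P: "P \<subseteq> T \<Longrightarrow> T \<subseteq> V \<Longrightarrow> a \<in> U \<Longrightarrow> b \<in> U \<Longrightarrow> a \<noteq> b \<Longrightarrow> \<not> twins T a b"
  by (rule nontwins_same_side) (auto simp: U_pattern, auto simp: U_def)

lemma P_nontwins:
  assumes T: "P \<subseteq> T" "T \<subseteq> V" and x: "x \<in> X" "x \<in> T" and ab: "a \<in> P" "b \<in> P" "a \<noteq> b"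
  shows "\<not> twins T a b"
proof (cases "E a x = E b x")
  case True
  then have "(a \<in> U \<and> b \<in> U) \<or> (a \<in> W \<and> b \<in> W)"
    using P_cases[OF ab(1)] P_cases[OF ab(2)] U_pattern[OF _ x(1)] W_pattern[OF _ x(1)] by blast
  then show ?thesis using T ab by (intro nontwins_same_side) (auto simp: U_pattern W_pattern)
qed (use x in auto)

lemma agree_on_P:
  assumes "x \<in> X" "y \<in> X" "E u x = E u y"
  shows "twins P x y"
proof
  fix a assume "a \<in> P"
  then have "E a x = E a y" using P_cases[of a] U_pattern W_pattern assms by blast
  then show "E x a = E y a" using E_sym[of x a] E_sym[of y a] by simp
qed

text \<open>Here more than n/256 pairwise non-twins in \<open>U\<close> meet the bound m(r - 16) +
  1, which is too small by a factor of 256.\<close>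

lemma rk_P: "r < rk P + 16"
proof (rule ccontr)
  assume "\<not> r < rk P + 16"
  moreover have PV: "P \<subseteq> V" using PH HV by blast
  ultimately have "card U \<le> max_order (r - 16) + 1"
    using r_ge U_nontwins_P[OF order_refl PV] by (intro card_nontwins[OF PV]) (auto simp: U_def)
  then show False using order_step_16 card_U order_gt by linarith
qed

lemma card_side: "card {x \<in> X. E u x = s} \<le> 2 ^ 15"
proof -
  have "card {x \<in> X. E u x = s} \<le> 2 ^ (r - rk P)"
    using XV PH HV agree_on_P by (intro card_agreeing) auto
  also have "\<dots> \<le> 2 ^ 15" using rk_P by (intro power_increasing) auto
  finally show ?thesis .
qed

lemma card_X: "card X = card {x \<in> X. E u x = True} + card {x \<in> X. E u x = False}"
  using fin by (subst card_Un_disjoint[symmetric]) (auto intro: arg_cong[where f = card])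

text \<open>A relation among the rows of x, y, u, v vanishes on \<open>T\<close> but not everywhere,
  so \<open>T\<close> has smaller rank. \<open>T\<close> keeps all of \<open>P\<close>, and
  \<open>x\<close> in \<open>T\<close> separates the sides, so \<open>P\<close> stays free of twins.
  But card P > n - 2 card X is nearly n, while m(r - 1) is at most about 4/5 m(r).\<close>

lemma same_side_unique:
  assumes x: "x \<in> X" and y: "y \<in> X" and same: "E u x = E u y"
  shows "x = y"
proof (rule ccontr)
  assume xy: "x \<noteq> y"
  \<comment> \<open>The multiple of \<open>c\<close> in \<open>f\<close> is chosen such that \<open>f x = 0\<close>: then \<open>x\<close> survives in \<open>T\<close> and separates \<open>U\<close> from \<open>W\<close>.\<close>
  define c where "c = (\<lambda>t. A u t - A v t)"
  define z where "z = (\<lambda>w. of_bool (w = x) - of_bool (w = y) + A x y * c x * (of_bool (w = u) - of_bool (w = v)))"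
  define f where "f = (\<lambda>t. A x t - A y t + A x y * c x * c t)"
  define T where "T = {t \<in> V. f t = 0}"
  have xyV: "x \<in> V" "y \<in> V" using x y XV by auto
  have f: "(\<Sum>w\<in>V. z w * A w t) = f t" for t
  proof -
    have "(\<Sum>w\<in>V. z w * A w t) = (\<Sum>w\<in>V. (of_bool (w = x) - of_bool (w = y)) * A w t) +
       A x y * c x * (\<Sum>w\<in>V. (of_bool (w = u) - of_bool (w = v)) * A w t)"
      unfolding z_def sum_distrib_left sum.distrib[symmetric] by (intro sum.cong) (auto simp: algebra_simps)
    then show ?thesis
      unfolding sum_indicator_diff[OF finite_V xyV] sum_indicator_diff[OF finite_V uV vV] by (simp add: f_def c_def)
  qed
  have cc: "c x * c x = 1" "c x * c y = 1"
    using X_iff[OF x] X_iff[OF y] same by (auto simp: c_def A_def)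
  have A0: "A x x = 0" "A y y = 0" "A y x = A x y" using E_irrefl A_sym by (auto simp: A_def)
  have TV: "T \<subseteq> V" by (auto simp: T_def)
  have xT: "x \<in> T" using xyV cc A0 by (simp add: T_def f_def mult.assoc)
  obtain t where t: "t \<in> V" "f t \<noteq> 0"
  proof (cases "E x y")
    case True
    have "f y = 2" using True cc A0 by (simp add: f_def mult.assoc) (simp add: A_def)
    then show ?thesis using that[of y] xyV by simp
  next
    case False
    obtain t where "t \<in> V" "E x t \<noteq> E y t" using no_twins[OF xyV xy] by blast
    moreover have "A x y = 0" using False by (simp add: A_def)
    ultimately show ?thesis using that[of t] by (auto simp: f_def A_def split: if_splits)
  qed
  have "rk T < r"
    by (rule rk_less_if_relation[OF TV, of z t]) (use t in \<open>auto simp: f T_def\<close>)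
  moreover have PT: "P \<subseteq> T"
  proof
    fix a assume a: "a \<in> P"
    then have "a \<in> H" using PH by blast
    then have "c a = 0" using H_iff[of a] by (simp add: c_def A_eq_iff)
    moreover have "A x a = A y a" using agree_on_P[OF x y same] a by (simp add: A_eq_iff)
    ultimately show "a \<in> T" using \<open>a \<in> H\<close> HV by (auto simp: T_def f_def)
  qed
  ultimately have "card P \<le> max_order (r - 1) + 1"
    using r_ge P_nontwins[OF PT TV x xT] by (intro card_nontwins[OF TV]) auto
  \<comment> \<open>Two sides of at most 2^15 vertices each, negligible against m(r)/5.\<close>
  moreover have "card X \<le> 65536" using card_X card_side[of True] card_side[of False] by simp
  ultimately show False
    using card_P card_V card_S order_step_1 order_gt order_large by linarith
qed

text \<open>This removes the summand 1 of \<open>card_nontwins\<close>, which the final count cannot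
  afford.\<close>

lemma no_isolated_in_H:
  assumes a: "a \<in> U \<union> S"
  shows "\<exists>w\<in>H. E a w"
proof (rule ccontr)
  assume iso: "\<not> (\<exists>w\<in>H. E a w)"
  have aH: "a \<in> H" using a US_H by blast
  obtain x where x: "x \<in> V" "E a x" using no_isolated[of a] aH HV by blast
  then have xX: "x \<in> X" using iso by (auto simp: H_def)
  show False
  proof (cases "X = {x0}")
    case True
    \<comment> \<open>With \<open>S\<close> empty, \<open>a\<close> has a partner; it is also
      isolated in \<open>H\<close> and, being complementary to \<open>a\<close> at
      \<open>x0\<close>, isolated in the whole graph.\<close>
    then have "S = {}" using card_S fin by simp
    then have aP: "a \<in> P" using a by (auto simp: U_def)
    from partner[OF aP] obtain b where b: "b \<in> P" "twins H a b" "\<forall>x\<in>X. E b x \<longleftrightarrow> \<not> E a x"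
      by (elim exE conjE) (rule that)
    have "\<not> E b w" if "w \<in> V" for w
      using that iso b x xX True by (cases "w \<in> H") (auto simp: H_def)
    then show False using no_isolated[of b] b PH HV by blast
  next
    case False
    then obtain y where y: "y \<in> X" "y \<noteq> x0" using x0X by blast
    then have ny: "\<not> E u y" using same_side_unique[OF y(1) x0X] x0(2) by auto
    have "x = x0 \<or> x = y" using same_side_unique[OF xX x0X] same_side_unique[OF xX y(1)] x0(2) ny by auto
    then have axy: "E a x0 \<or> E a y" using x by auto
    \<comment> \<open>On x0, y the first kernel vector takes the values 1, -1, the second
      nonnegative values that are not both zero; these are never proportional.\<close>
    have "rk H + 4 \<le> r"
    proof (rule rk_two_kernel_vectors[OF HV, where zp = "\<lambda>w. of_bool (w = u) - of_bool (w = v)"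
          and zq = "\<lambda>w. of_bool (w = a)"])
      show "x0 \<in> V - H" "y \<in> V - H" using x0X y XV by (auto simp: H_def)
      show "x0 \<noteq> y" using y by simp
      show "(\<Sum>w\<in>H. (of_bool (w = u) - of_bool (w = v)) * A w t) = 0" if "t \<in> H" for t
        using that H_iff[OF that] by (simp add: sum_indicator_diff fin uH vH A_eq_iff)
      show "(\<Sum>w\<in>H. of_bool (w = a) * A w t) = 0" if "t \<in> H" for t
        unfolding sum_indicator_row[OF fin(2) aH] using that iso by (auto simp: A_def)
      show "(\<Sum>w\<in>H. (of_bool (w = u) - of_bool (w = v)) * A w x0) * (\<Sum>w\<in>H. of_bool (w = a) * A w y) \<noteq>
        (\<Sum>w\<in>H. (of_bool (w = u) - of_bool (w = v)) * A w y) * (\<Sum>w\<in>H. of_bool (w = a) * A w x0)"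
        using axy x0 ny X_iff[OF y(1)]
        unfolding sum_indicator_diff[OF fin(2) uH vH] sum_indicator_row[OF fin(2) aH]
        by (auto simp: A_def)
    qed
    then show False using rk_H' by simp
  qed
qed

text \<open>Each side of \<open>X\<close> has at most one vertex, so n <= 2 + 2 m(r - 2) = m(r),
  with no slack left.\<close>

lemma contradiction: False
proof -
  have "card U + card S \<le> max_order (r - 2)"
    unfolding card_US[symmetric] using rk_H r_ge nontwins_US no_isolated_in_H
    by (intro card_nontwins_connected[OF HV _ _ US_H]) auto
  moreover have "card {x \<in> X. E u x = s} \<le> 1" for s
    using same_side_unique fin by (intro card_le_Suc0_iff_eq[THEN iffD2, folded One_nat_def]) auto
  then have "card X \<le> 1 + 1" unfolding card_X by (intro add_mono)
  ultimately show False using card_V order_step_2 order_gt by linarith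
qed

end

context minimal_counterexample
begin

lemma nonadjacent_far:
  assumes "a \<in> V" "b \<in> V" "a \<noteq> b" "\<not> E a b"
  shows "127 * card V \<le> 256 * card (diff a b)"
proof (rule ccontr)
  assume n: "\<not> 127 * card V \<le> 256 * card (diff a b)"
  define R where "R = {(u, v). u \<in> V \<and> v \<in> V \<and> u \<noteq> v \<and> \<not> E u v}"
  have "(a, b) \<in> R" using assms by (auto simp: R_def)
  then obtain p where p: "p \<in> R" "\<And>q. q \<in> R \<Longrightarrow> card (case_prod diff p) \<le> card (case_prod diff q)"
    using ex_has_least_nat[of "\<lambda>p. p \<in> R" "(a, b)" "\<lambda>p. card (case_prod diff p)"] by blast
  obtain u v where uv: "p = (u, v)" by (cases p)
  have uvR: "u \<in> V" "v \<in> V" "u \<noteq> v" "\<not> E u v" using p(1) uv by (auto simp: R_def)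
  have closest: "card (diff u v) \<le> card (diff a' b')" if "a' \<in> V" "b' \<in> V" "a' \<noteq> b'" "\<not> E a' b'" for a' b'
    using p(2)[of "(a', b')"] that uv by (auto simp: R_def)
  have close: "256 * card (diff u v) < 127 * card V" using closest[OF assms] n by linarith
  have sym: "diff v u = diff u v" by (auto simp: diff_def)
  obtain x where x: "x \<in> V" "E u x \<noteq> E v x" using no_twins[OF uvR(1-3)] by blast
  show False
  proof (cases "E u x")
    case True
    interpret close_nonadjacent_pair V E r A rk u v x
      by unfold_locales (use uvR closest close x True in auto)
    show False by (rule contradiction)
  next
    case False
    interpret close_nonadjacent_pair V E r A rk v u x
      by unfold_locales (use uvR closest close x False sym E_sym[of u v] in auto)
    show False by (rule contradiction)
  qed
qed

end

section \<open>Distances and the spherical code\<close>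

context minimal_counterexample
begin

text \<open>Deleting both difference sets leaves \<open>T\<close> with three agreeing rows, hence
  rank at most r - 2. Twins in \<open>T\<close> would be non-adjacent and differ only on the deleted
  set, too close by \<open>nonadjacent_far\<close>. So \<open>T\<close> has at most m(r - 2) + 1
  vertices, fewer than n/2.\<close>

lemma triple_far:
  assumes V: "x \<in> V" "y \<in> V" "z \<in> V" and ne: "x \<noteq> y" "x \<noteq> z" "y \<noteq> z"
  shows "127 * card V \<le> 256 * card (diff x y \<union> diff x z)"
proof (rule ccontr)
  let ?D = "diff x y \<union> diff x z"
  define T where "T = V - ?D"
  assume n: "\<not> 127 * card V \<le> 256 * card ?D"
  have TV: "T \<subseteq> V" by (auto simp: T_def)
  have DV: "?D \<subseteq> V" using diff_subset by blast
  have tw: "E x t = E y t" "E x t = E z t" if "t \<in> T" for t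
    using that by (auto simp: T_def diff_def)
  have "card {x, y, z} \<le> 2 ^ (r - rk T)"
    using V tw by (intro card_agreeing[OF _ TV]) auto
  then have "2 ^ 1 < (2::nat) ^ (r - rk T)" using ne by simp
  then have "1 < r - rk T" by (rule power_less_imp_less_exp[rotated]) simp
  then have "rk T \<le> r - 2" by linarith
  moreover have "\<not> twins T a b" if ab: "a \<in> T" "b \<in> T" "a \<noteq> b" for a b
  proof
    assume tab: "twins T a b"
    have "\<not> E a b" using tab ab E_irrefl[of b] by auto
    then have "127 * card V \<le> 256 * card (diff a b)" using ab TV by (intro nonadjacent_far) auto
    moreover have "diff a b \<subseteq> ?D"
    proof
      fix w assume "w \<in> diff a b"
      then have w: "w \<in> V" "E a w \<noteq> E b w" by (auto simp: diff_def)
      then have "w \<notin> T" using tab by blast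
      then show "w \<in> ?D" using w(1) by (simp add: T_def)
    qed
    then have "card (diff a b) \<le> card ?D" by (intro card_mono) auto
    ultimately show False using n by linarith
  qed
  ultimately have "card T \<le> max_order (r - 2) + 1"
    using r_ge by (intro card_nontwins[OF TV]) auto
  moreover have "card T = card V - card ?D" unfolding T_def using DV by (intro card_Diff_subset) auto
  ultimately show False using n order_step_2 order_gt by linarith
qed

lemma card_as_sum: "real (card {w \<in> V. Q w}) = (\<Sum>w\<in>V. of_bool (Q w))"
  using finite_V by (simp add: of_bool_def sum.If_cases Int_def)

text \<open>Three truth values that are not all equal disagree in exactly two of the three pairs, so
  the perimeter is twice the size of the union.\<close>

lemma triple_perimeter:
  assumes V: "x \<in> V" "y \<in> V" "z \<in> V" and ne: "x \<noteq> y" "x \<noteq> z" "y \<noteq> z"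
  shows "127 / 128 * real (card V) \<le> card (diff x y) + card (diff y z) + card (diff z x)"
proof -
  have "diff x y \<union> diff x z = {w \<in> V. E x w \<noteq> E y w \<or> E x w \<noteq> E z w}" by (auto simp: diff_def)
  then have "2 * real (card (diff x y \<union> diff x z)) = (\<Sum>w\<in>V. 2 * of_bool (E x w \<noteq> E y w \<or> E x w \<noteq> E z w))"
    by (simp only: card_as_sum sum_distrib_left)
  also have "\<dots> = (\<Sum>w\<in>V. of_bool (E x w \<noteq> E y w) + of_bool (E y w \<noteq> E z w) + of_bool (E z w \<noteq> E x w))"
    by (intro sum.cong) auto
  also have "\<dots> = card (diff x y) + card (diff y z) + card (diff z x)"
    by (simp only: sum.distrib card_as_sum[symmetric] diff_def of_nat_add)
  finally show ?thesis using triple_far[OF assms] by linarith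
qed

text \<open>Perimeters are summed over ordered triples of distinct elements: k(k-1)(k-2) triples,
  with each ordered pair counted 3(k-2) times. Hence the constant (127/128)/3 = 127/384.\<close>

lemma sum_distances:
  assumes I: "I \<subseteq> V" and k: "3 \<le> card I"
  shows "127 / 384 * real (card V) * real (card I) * (real (card I) - 1) \<le> (\<Sum>x\<in>I. \<Sum>y\<in>I. real (card (diff x y)))"
proof -
  have finI: "finite I" using I by (rule finite_sub)
  define d where "d = (\<lambda>x y. real (card (diff x y)))"
  define C where "C = 127 / 128 * real (card V)"
  define k where "k = real (card I)"
  define s where "s = (\<Sum>x\<in>I. \<Sum>y\<in>I. d x y)"
  have d0: "d x x = 0" and ds: "d x y = d y x" for x y
  proof -
    show "d x x = 0" by (simp add: d_def diff_def)
    have "diff x y = diff y x" by (auto simp: diff_def)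
    then show "d x y = d y x" by (simp add: d_def)
  qed
  \<comment> \<open>\<open>L\<close> is \<open>C\<close> on triples of distinct elements and equals the perimeter on all others.\<close>
  define L where "L = (\<lambda>x y z. C - C * (if y = x then 1 else 0) - C * (if z = y then 1 else 0) - C * (if z = x then 1 else 0)
      + 2 * C * (if z = y then (if y = x then 1 else 0) else 0)
      + 2 * d x z * (if y = x then 1 else 0) + 2 * d x y * (if z = y then 1 else 0) + 2 * d x y * (if z = x then 1 else 0))"
  have pt: "L x y z \<le> d x y + d y z + d z x" if "x \<in> I" "y \<in> I" "z \<in> I" for x y z
  proof -
    consider "x = y" "y = z" | "x = y" "y \<noteq> z" | "x \<noteq> y" "y = z" | "x \<noteq> y" "x = z" | "x \<noteq> y" "y \<noteq> z" "x \<noteq> z" by blast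
    then show ?thesis
    proof cases
      case 5
      then have "C \<le> d x y + d y z + d z x"
        using triple_perimeter[of x y z] that I by (auto simp: C_def d_def)
      then show ?thesis using 5 by (simp add: L_def)
    qed (use d0 ds in \<open>auto simp: L_def\<close>)
  qed
  have "(\<Sum>x\<in>I. \<Sum>y\<in>I. \<Sum>z\<in>I. L x y z) \<le> (\<Sum>x\<in>I. \<Sum>y\<in>I. \<Sum>z\<in>I. d x y + d y z + d z x)"
    by (intro sum_mono pt)
  also have "\<dots> = 3 * k * s"
  proof -
    have 1: "(\<Sum>x\<in>I. \<Sum>y\<in>I. \<Sum>z\<in>I. d x y) = k * s" by (simp add: k_def s_def sum_distrib_left)
    have 2: "(\<Sum>x\<in>I. \<Sum>y\<in>I. \<Sum>z\<in>I. d y z) = k * s" by (simp add: k_def s_def)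
    have "(\<Sum>x\<in>I. \<Sum>y\<in>I. \<Sum>z\<in>I. d z x) = (\<Sum>x\<in>I. k * (\<Sum>z\<in>I. d x z))"
      by (simp add: k_def ds[of _ _])
    then have 3: "(\<Sum>x\<in>I. \<Sum>y\<in>I. \<Sum>z\<in>I. d z x) = k * s" by (simp add: s_def sum_distrib_left)
    show ?thesis unfolding sum.distrib 1 2 3 by simp
  qed
  \<comment> \<open>Each of the three ways in which two indices coincide adds 2s, the exact
    perimeters of degenerate triples; moving 6s to the other side turns 3ks into 3(k - 2)s.\<close>
  also have "(\<Sum>x\<in>I. \<Sum>y\<in>I. \<Sum>z\<in>I. L x y z) = C * k * (k - 1) * (k - 2) + 6 * s"
  proof -
    have z: "(\<Sum>z\<in>I. L x y z) = C * k - k * C * (if y = x then 1 else 0) - 2 * C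
       + 2 * C * (if y = x then 1 else 0) + 2 * (\<Sum>z\<in>I. d x z) * (if y = x then 1 else 0) + 4 * d x y"
      if "x \<in> I" "y \<in> I" for x y
      using that finI
      by (simp add: L_def sum.distrib sum_subtractf sum_distrib_left[symmetric] sum_distrib_right[symmetric] sum.delta k_def)
    have y: "(\<Sum>y\<in>I. \<Sum>z\<in>I. L x y z) = C * k * k - k * C - 2 * C * k + 2 * C + 2 * (\<Sum>z\<in>I. d x z) + 4 * (\<Sum>y\<in>I. d x y)"
      if "x \<in> I" for x
    proof -
      have "(\<Sum>y\<in>I. \<Sum>z\<in>I. L x y z) = (\<Sum>y\<in>I. C * k - k * C * (if y = x then 1 else 0) - 2 * C
       + 2 * C * (if y = x then 1 else 0) + 2 * (\<Sum>z\<in>I. d x z) * (if y = x then 1 else 0) + 4 * d x y)"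
        using that by (intro sum.cong z) auto
      then show ?thesis using that finI
        by (simp add: sum.distrib sum_subtractf sum_distrib_left[symmetric] sum_distrib_right[symmetric] sum.delta k_def algebra_simps)
    qed
    have "(\<Sum>x\<in>I. \<Sum>y\<in>I. \<Sum>z\<in>I. L x y z) =
      (\<Sum>x\<in>I. C * k * k - k * C - 2 * C * k + 2 * C + 2 * (\<Sum>z\<in>I. d x z) + 4 * (\<Sum>y\<in>I. d x y))"
      by (intro sum.cong y) auto
    also have "\<dots> = k * (C * k * k - k * C - 2 * C * k + 2 * C) + 2 * s + 4 * s"
      by (simp only: sum.distrib sum_distrib_left[symmetric] s_def sum_constant k_def) (simp add: algebra_simps)
    finally show ?thesis by (simp add: algebra_simps)
  qed
  finally have "(k - 2) * (C * k * (k - 1)) \<le> (k - 2) * (3 * s)" by (simp add: algebra_simps)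
  moreover have "k - 2 > 0" using assms(2) by (simp add: k_def)
  ultimately have "C * k * (k - 1) \<le> 3 * s" by (simp only: mult_le_cancel_left_pos)
  moreover have "127 / 384 * real (card V) * k * (k - 1) = C * k * (k - 1) / 3" by (simp add: C_def)
  ultimately show ?thesis unfolding s_def d_def k_def by linarith
qed

section \<open>The spherical code\<close>

lemma card_V_pos: "0 < real (card V)"
  using order_gt by simp

text \<open>Rows with 0, 1 replaced by 1, -1 lie in the span of the rows and the all-ones vector, of
  dimension at most r + 1. The sum over \<open>V\<close> of the product of two such rows is n minus
  twice the distance.\<close>

lemma sphere_coordinates:
  obtains g :: "'a \<Rightarrow> nat \<Rightarrow> real"
  where "\<And>x y. x \<in> V \<Longrightarrow> y \<in> V \<Longrightarrow> (\<Sum>k<Suc r. g x k * g y k) = 1 - 2 * real (card (diff x y)) / real (card V)"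
proof -
  obtain B0 where B0: "B0 \<subseteq> row_on A V ` V" "fun_vs.independent B0" "row_on A V ` V \<subseteq> fun_vs.span B0"
      "card B0 = fun_vs.dim (row_on A V ` V)"
    by (rule fun_vs.basis_exists)
  define one where "one = (\<lambda>v. if v \<in> V then 1 else (0::real))"
  define B where "B = insert one B0"
  have fB0: "finite B0" using B0(1) finite_V finite_subset by blast
  then have finB: "finite B" by (simp add: B_def)
  have "card B0 = r" using B0(4) rk_V by (simp add: rk_def set_matrix_rank_row_on)
  then have cB: "card B \<le> Suc r" using fB0 by (simp add: B_def card_insert_if)
  define s where "s = (\<lambda>x. one - (\<lambda>v. 2 * row_on A V x v))"
  have span: "s x \<in> fun_vs.span B" if "x \<in> V" for x
  proof -
    have "row_on A V x \<in> fun_vs.span B0" using B0(3) that by blast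
    then have "row_on A V x \<in> fun_vs.span B" using fun_vs.span_mono[of B0 B] by (auto simp: B_def)
    moreover have "one \<in> fun_vs.span B" by (intro fun_vs.span_base) (simp add: B_def)
    ultimately show ?thesis unfolding s_def by (intro fun_vs.span_diff fun_vs.span_scale)
  qed
  obtain e :: "nat \<Rightarrow> 'a \<Rightarrow> real" where e: "\<And>f g. f \<in> fun_vs.span B \<Longrightarrow>
      (\<Sum>v\<in>V. f v * g v) = (\<Sum>k<card B. (\<Sum>v\<in>V. f v * e k v) * (\<Sum>v\<in>V. e k v * g v))"
    using orthonormal_coordinates[OF finite_V finB] by blast
  \<comment> \<open>Zero coordinates pad the vectors to length \<open>Suc r\<close> when
    \<open>B\<close> is smaller.\<close>
  define g where "g = (\<lambda>x k. if k < card B then (\<Sum>v\<in>V. s x v * e k v) / sqrt (card V) else 0)"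
  show thesis
  proof (rule that)
    fix x y assume xy: "x \<in> V" "y \<in> V"
    have "(\<Sum>k<Suc r. g x k * g y k) = (\<Sum>k<card B. g x k * g y k)"
      using cB by (intro sum.mono_neutral_right) (auto simp: g_def)
    also have "\<dots> = (\<Sum>k<card B. (\<Sum>v\<in>V. s x v * e k v) * (\<Sum>v\<in>V. e k v * s y v) / real (card V))"
      by (intro sum.cong) (auto simp: g_def mult.commute[of "e _ _"])
    also have "\<dots> = (\<Sum>v\<in>V. s x v * s y v) / real (card V)"
      by (simp only: e[OF span[OF xy(1)], of "s y"] sum_divide_distrib)
    also have "(\<Sum>v\<in>V. s x v * s y v) = (\<Sum>v\<in>V. 1 - 2 * of_bool (E x v \<noteq> E y v))"
      by (intro sum.cong) (auto simp: s_def one_def row_on_def A_def)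
    also have "\<dots> = real (card V) - 2 * real (card (diff x y))"
      by (simp only: sum_subtractf sum_distrib_left[symmetric] card_as_sum[symmetric] diff_def) simp
    also have "\<dots> / real (card V) = 1 - 2 * real (card (diff x y)) / real (card V)"
      using card_V_pos by (simp add: diff_divide_distrib)
    finally show "(\<Sum>k<Suc r. g x k * g y k) = 1 - 2 * real (card (diff x y)) / real (card V)" .
  qed
qed

text \<open>By Cauchy-Schwarz, c unit vectors in the cap have a sum of length at least 3c/5, so
  their mean inner product, diagonal included, is at least 9/25. The distance sum bounds it above by
  1 - 127/192 * (c - 1)/c. The two are compatible up to c = 30 and not for c >= 31.\<close>

lemma card_cap:
  assumes g: "\<And>x y. x \<in> V \<Longrightarrow> y \<in> V \<Longrightarrow> (\<Sum>k<m. g x k * g y k) = 1 - 2 * real (card (diff x y)) / real (card V)"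
    and Y: "0 < (\<Sum>k<m. (y k)\<^sup>2)"
  shows "card {i \<in> V. 3/5 * sqrt (\<Sum>k<m. (y k)\<^sup>2) \<le> (\<Sum>k<m. g i k * y k)} \<le> 30"
proof (rule ccontr)
  define I where "I = {i \<in> V. 3/5 * sqrt (\<Sum>k<m. (y k)\<^sup>2) \<le> (\<Sum>k<m. g i k * y k)}"
  define Q where "Q = (\<Sum>k<m. (y k)\<^sup>2)"
  define c where "c = real (card I)"
  define D where "D = (\<Sum>i\<in>I. \<Sum>j\<in>I. real (card (diff i j)))"
  assume "\<not> card {i \<in> V. 3/5 * sqrt (\<Sum>k<m. (y k)\<^sup>2) \<le> (\<Sum>k<m. g i k * y k)} \<le> 30"
  then have cI: "31 \<le> card I" by (simp add: I_def)
  then have c: "31 \<le> c" by (simp add: c_def)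
  have IV: "I \<subseteq> V" by (auto simp: I_def)
  have "c * (3/5 * sqrt Q) = (\<Sum>i\<in>I. 3/5 * sqrt Q)" by (simp add: c_def)
  also have "\<dots> \<le> (\<Sum>i\<in>I. \<Sum>k<m. g i k * y k)"
    by (intro sum_mono) (auto simp: I_def Q_def)
  also have "\<dots> = (\<Sum>k<m. (\<Sum>i\<in>I. g i k) * y k)"
    by (subst sum.swap) (simp add: sum_distrib_right)
  finally have "(c * (3/5 * sqrt Q))\<^sup>2 \<le> (\<Sum>k<m. (\<Sum>i\<in>I. g i k) * y k)\<^sup>2"
    using c Y by (intro power_mono) (auto simp: Q_def)
  also have "\<dots> \<le> (\<Sum>k<m. (\<Sum>i\<in>I. g i k)\<^sup>2) * Q"
    unfolding Q_def by (rule Cauchy_Schwarz_ineq_sum)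
  also have "(\<Sum>k<m. (\<Sum>i\<in>I. g i k)\<^sup>2) = (\<Sum>i\<in>I. \<Sum>j\<in>I. \<Sum>k<m. g i k * g j k)"
  proof -
    have "(\<Sum>k<m. (\<Sum>i\<in>I. g i k)\<^sup>2) = (\<Sum>k<m. \<Sum>i\<in>I. \<Sum>j\<in>I. g i k * g j k)"
      by (simp add: power2_eq_square sum_product)
    also have "\<dots> = (\<Sum>i\<in>I. \<Sum>k<m. \<Sum>j\<in>I. g i k * g j k)" by (rule sum.swap)
    also have "\<dots> = (\<Sum>i\<in>I. \<Sum>j\<in>I. \<Sum>k<m. g i k * g j k)" by (intro sum.cong sum.swap) auto
    finally show ?thesis .
  qed
  also have "\<dots> = (\<Sum>i\<in>I. \<Sum>j\<in>I. 1 - 2 / real (card V) * real (card (diff i j)))"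
    using IV by (intro sum.cong) (auto simp: g subset_iff)
  also have "\<dots> = c * c - 2 / real (card V) * D"
    by (simp only: sum_subtractf sum_distrib_left[symmetric] D_def sum_constant c_def)
  finally have "(c * (3/5 * sqrt Q))\<^sup>2 \<le> (c * c - 2 / real (card V) * D) * Q" .
  moreover have "(sqrt Q)\<^sup>2 = Q" using Y by (simp add: Q_def)
  then have "(c * (3/5 * sqrt Q))\<^sup>2 = (9/25 * (c * c)) * Q"
    by (simp only: power_mult_distrib) (simp add: power2_eq_square)
  ultimately have "(9/25 * (c * c)) * Q \<le> (c * c - 2 / real (card V) * D) * Q" by simp
  then have le: "9/25 * (c * c) \<le> c * c - 2 / real (card V) * D"
    using Y by (simp only: Q_def mult_le_cancel_right_pos)
  have "127 / 384 * real (card V) * c * (c - 1) \<le> D"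
    unfolding c_def D_def using cI by (intro sum_distances[OF IV]) simp
  then have "2 / real (card V) * (127 / 384 * real (card V) * c * (c - 1)) \<le> 2 / real (card V) * D"
    using card_V_pos by (intro mult_left_mono) auto
  then have "127 / 192 * c * (c - 1) \<le> 2 / real (card V) * D" using card_V_pos by simp
  with le have "c * (9/25 * c) \<le> c * (c - 127 / 192 * (c - 1))" by (simp add: algebra_simps)
  then have "9/25 * c \<le> c - 127 / 192 * (c - 1)" using c by (simp only: mult_le_cancel_left_pos)
  then show False using c by simp
qed

theorem no_counterexample: False
proof -
  obtain g :: "'a \<Rightarrow> nat \<Rightarrow> real" where g: "\<And>x y. x \<in> V \<Longrightarrow> y \<in> V \<Longrightarrow>
      (\<Sum>k<Suc r. g x k * g y k) = 1 - 2 * real (card (diff x y)) / real (card V)"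
    using sphere_coordinates by blast
  define R where "R = real r + 1"
  have R: "48 \<le> R" using r_ge by (simp add: R_def)
  have "card V * ((3/5 / (real r + 1) + 16/25 / (real r + 2)) * (4/5) ^ r) \<le> real 30 * sqrt (2 * pi / (real r + 1))"
  proof (rule spherical_cap_bound[OF finite_V])
    show "(\<Sum>k<Suc r. (g i k)\<^sup>2) = 1" if "i \<in> V" for i
    proof -
      have "diff i i = {}" by (simp add: diff_def)
      then show ?thesis using g[OF that that] by (simp only: power2_eq_square) simp
    qed
  qed (rule card_cap[OF g])
  then have "card V * ((3/5 / R + 16/25 / (R + 1)) * (4/5) ^ r) \<le> 30 * sqrt (2 * pi / R)"
    by (simp add: R_def add.assoc)
  \<comment> \<open>Both fractions get the denominator R, with 61/50 = 3/5 + 31/50; this needs R >=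
    31.\<close>
  moreover have "31/50 / R \<le> 16/25 / (R + 1)" using R by (simp add: field_simps)
  then have "61/50 / R \<le> 3/5 / R + 16/25 / (R + 1)" by simp
  then have "card V * ((61/50 / R) * (4/5) ^ r) \<le> card V * ((3/5 / R + 16/25 / (R + 1)) * (4/5) ^ r)"
    by (intro mult_left_mono mult_right_mono) auto
  \<comment> \<open>Squaring 30 * sqrt (8 / R) gives the constant 7200 = 30^2 * 8.\<close>
  moreover have "sqrt (2 * pi / R) \<le> sqrt (8 / R)"
    using R pi_less_4 by (intro real_sqrt_le_mono divide_right_mono) auto
  ultimately have "card V * ((61/50 / R) * (4/5) ^ r) \<le> 30 * sqrt (8 / R)" by linarith
  then have "(card V * ((61/50 / R) * (4/5) ^ r))\<^sup>2 \<le> (30 * sqrt (8 / R))\<^sup>2"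
    using R by (intro power_mono) auto
  moreover have "(30 * sqrt (8 / R))\<^sup>2 = 7200 / R" using R by (simp add: power_mult_distrib)
  moreover have "(card V * ((61/50 / R) * (4/5) ^ r))\<^sup>2 = (real (card V))\<^sup>2 * (61/50)\<^sup>2 * (16/25) ^ r / R\<^sup>2"
  proof -
    have "((4/5 :: real) ^ r)\<^sup>2 = (4/5 * (4/5)) ^ r" by (simp only: power2_eq_square power_mult_distrib)
    then have e: "((4/5 :: real) ^ r)\<^sup>2 = (16/25) ^ r" by simp
    have "(card V * ((61/50 / R) * (4/5) ^ r))\<^sup>2 = (real (card V))\<^sup>2 * ((61/50)\<^sup>2 / R\<^sup>2 * (16/25) ^ r)"
      by (simp only: power_mult_distrib e power_divide[of "61/50" R])
    then show ?thesis by simp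
  qed
  ultimately have "(real (card V))\<^sup>2 * (61/50)\<^sup>2 * (16/25) ^ r / R\<^sup>2 \<le> 7200 / R" by simp
  then have "(real (card V))\<^sup>2 * (61/50)\<^sup>2 * (16/25) ^ r \<le> 7200 / R * R\<^sup>2"
    using R by (simp only: pos_divide_le_eq zero_less_power)
  also have "7200 / R * R\<^sup>2 = 7200 * R" using R by (simp add: power2_eq_square)
  finally have "(real (card V))\<^sup>2 * (61/50)\<^sup>2 * (16/25) ^ r \<le> 7200 * (real r + 1)" by (simp add: R_def)
  moreover have "(real (max_order r) + 1)\<^sup>2 \<le> (real (card V))\<^sup>2" using order_gt by (intro power_mono) auto
  then have "(real (max_order r) + 1)\<^sup>2 * ((61/50)\<^sup>2 * (16/25) ^ r) \<le> (real (card V))\<^sup>2 * ((61/50)\<^sup>2 * (16/25) ^ r)"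
    by (intro mult_right_mono) auto
  ultimately show False using cap_bound_violated[OF r_ge] unfolding mult.assoc by linarith
qed

end

section \<open>Relabelling and conclusion\<close>

lemma pair_graphI:
  assumes "finite V" "\<And>u v. (u, v) \<in> R \<Longrightarrow> u \<in> V \<and> v \<in> V \<and> u \<noteq> v \<and> (v, u) \<in> R"
  shows "pair_graph \<lparr>pverts = V, parcs = R\<rparr>"
proof
  show "symmetric (with_proj \<lparr>pverts = V, parcs = R\<rparr>)"
    using assms(2) by (auto simp: symmetric_def intro!: symI)
  have "R \<subseteq> V \<times> V" using assms(2) by auto
  then show "finite (parcs \<lparr>pverts = V, parcs = R\<rparr>)" using assms(1) by (auto intro: finite_subset)
qed (use assms in auto)

lemma reduced_graph_iff:
  assumes "\<And>u v. (u, v) \<in> parcs G \<Longrightarrow> v \<in> pverts G"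
  shows "reduced_graph G \<longleftrightarrow>
    (\<forall>u\<in>pverts G. \<exists>v\<in>pverts G. (u, v) \<in> parcs G) \<and>
    (\<forall>u\<in>pverts G. \<forall>v\<in>pverts G. u \<noteq> v \<longrightarrow> (\<exists>w\<in>pverts G. ((u, w) \<in> parcs G) \<noteq> ((v, w) \<in> parcs G)))"
proof -
  have "neighbors G u \<noteq> {} \<longleftrightarrow> (\<exists>v\<in>pverts G. (u, v) \<in> parcs G)" for u
    using assms by (auto simp: neighbors_def)
  moreover have "neighbors G u \<noteq> neighbors G v \<longleftrightarrow> (\<exists>w\<in>pverts G. ((u, w) \<in> parcs G) \<noteq> ((v, w) \<in> parcs G))" for u v
    using assms[of u] assms[of v] by (auto simp: neighbors_def set_eq_iff)
  ultimately show ?thesis by (simp add: reduced_graph_def)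
qed

lemma graph_rank_of_bool:
  "graph_rank G = set_matrix_rank (pverts G) (\<lambda>u v. of_bool ((u, v) \<in> parcs G))"
  unfolding graph_rank_def by (intro set_matrix_rank_cong) (simp add: adjacency_matrix_def)

lemma pair_graph_facts:
  assumes "pair_graph G"
  shows "finite (pverts G)" "(u, v) \<in> parcs G \<Longrightarrow> u \<in> pverts G" "(u, v) \<in> parcs G \<Longrightarrow> v \<in> pverts G"
    "(u, v) \<in> parcs G \<longleftrightarrow> (v, u) \<in> parcs G" "(u, u) \<notin> parcs G"
proof -
  interpret pair_graph G by fact
  show "finite (pverts G)" by (rule pair_finite_verts)
  show "(u, v) \<in> parcs G \<Longrightarrow> u \<in> pverts G" using arc_fst_in_verts[of "(u, v)"] by simp
  show "(u, v) \<in> parcs G \<Longrightarrow> v \<in> pverts G" using arc_snd_in_verts[of "(u, v)"] by simp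
  show "(u, v) \<in> parcs G \<longleftrightarrow> (v, u) \<in> parcs G" using arcs_symmetric by blast
  show "(u, u) \<notin> parcs G" using pair_no_loops[of "(u, u)"] by auto
qed

text \<open>An assumption cannot be polymorphic in the vertex type, so the base cases are assumed
  for \<open>nat\<close> vertices and other graphs are copied there. Reindexing in both directions
  shows equal rank.\<close>

lemma reduced_graph_to_nat:
  fixes G :: "'a pair_pre_digraph"
  assumes G: "pair_graph G" "reduced_graph G"
  obtains H :: "nat pair_pre_digraph" where "pair_graph H" "reduced_graph H"
    "graph_rank H = graph_rank G" "card (pverts H) = card (pverts G)"
proof -
  note fG = pair_graph_facts[OF G(1)]
  let ?V = "pverts G"
  obtain f :: "'a \<Rightarrow> nat" where f: "inj_on f ?V"
    using finite_imp_inj_to_nat_seg[OF fG(1)] by blast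
  define q where "q = inv_into ?V f"
  have qf: "q (f u) = u" if "u \<in> ?V" for u using f that by (simp add: q_def)
  define H where "H = \<lparr>pverts = f ` ?V, parcs = {(s, t). s \<in> f ` ?V \<and> t \<in> f ` ?V \<and> (q s, q t) \<in> parcs G}\<rparr>"
  have HE: "(f u, f v) \<in> parcs H \<longleftrightarrow> (u, v) \<in> parcs G" if "u \<in> ?V" "v \<in> ?V" for u v
    using that by (auto simp: H_def qf)
  have HV: "pverts H = f ` ?V" by (simp add: H_def)
  have pg: "pair_graph H"
    unfolding H_def by (rule pair_graphI) (use fG in auto)
  have red: "reduced_graph H"
  proof (subst reduced_graph_iff)
    show "\<And>u v. (u, v) \<in> parcs H \<Longrightarrow> v \<in> pverts H" by (auto simp: H_def)
    have r: "(\<forall>u\<in>?V. \<exists>v\<in>?V. (u, v) \<in> parcs G) \<and>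
      (\<forall>u\<in>?V. \<forall>v\<in>?V. u \<noteq> v \<longrightarrow> (\<exists>w\<in>?V. ((u, w) \<in> parcs G) \<noteq> ((v, w) \<in> parcs G)))"
      using G(2) fG(3) by (subst (asm) reduced_graph_iff) auto
    show "(\<forall>u\<in>pverts H. \<exists>v\<in>pverts H. (u, v) \<in> parcs H) \<and>
      (\<forall>u\<in>pverts H. \<forall>v\<in>pverts H. u \<noteq> v \<longrightarrow> (\<exists>w\<in>pverts H. ((u, w) \<in> parcs H) \<noteq> ((v, w) \<in> parcs H)))"
      unfolding HV ball_simps bex_simps
    proof (intro conjI ballI impI)
      fix u assume u: "u \<in> ?V"
      then obtain v where "v \<in> ?V" "(u, v) \<in> parcs G" using r by blast
      then show "\<exists>v\<in>?V. (f u, f v) \<in> parcs H" using HE u by blast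
    next
      fix u v assume uv: "u \<in> ?V" "v \<in> ?V" "f u \<noteq> f v"
      then have "u \<noteq> v" by auto
      with conjunct2[OF r] uv(1,2) have "\<exists>w\<in>?V. ((u, w) \<in> parcs G) \<noteq> ((v, w) \<in> parcs G)" by simp
      then obtain w where w: "w \<in> ?V" "((u, w) \<in> parcs G) \<noteq> ((v, w) \<in> parcs G)" by (rule bexE)
      then have "((f u, f w) \<in> parcs H) \<noteq> ((f v, f w) \<in> parcs H)" using HE uv by simp
      then show "\<exists>w\<in>?V. ((f u, f w) \<in> parcs H) \<noteq> ((f v, f w) \<in> parcs H)" using w(1) by (rule bexI)
    qed
  qed
  let ?A = "\<lambda>u v. of_bool ((u, v) \<in> parcs G) :: real" and ?B = "\<lambda>s t. of_bool ((s, t) \<in> parcs H) :: real"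
  have "set_matrix_rank (f ` ?V) ?B = set_matrix_rank (f ` ?V) (\<lambda>s t. ?A (q s) (q t))"
    by (rule set_matrix_rank_cong) (auto simp: HE qf)
  also have "\<dots> \<le> set_matrix_rank ?V ?A"
    using fG(1) by (intro set_matrix_rank_reindex_le) (auto simp: qf)
  finally have 1: "set_matrix_rank (f ` ?V) ?B \<le> set_matrix_rank ?V ?A" .
  have "set_matrix_rank ?V ?A = set_matrix_rank ?V (\<lambda>u v. ?B (f u) (f v))"
    by (rule set_matrix_rank_cong) (simp add: HE)
  also have "\<dots> \<le> set_matrix_rank (f ` ?V) ?B"
    using fG(1) by (intro set_matrix_rank_reindex_le) auto
  finally have "graph_rank H = graph_rank G" using 1 by (simp add: graph_rank_of_bool HV)
  moreover have "card (pverts H) = card ?V" unfolding HV by (rule card_image[OF f])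
  ultimately show thesis using pg red by (intro that)
qed

theorem theorem4p6:
  assumes "\<And>(r::nat) (H :: nat pair_pre_digraph).
      2 \<le> r \<Longrightarrow> r \<le> 46 \<Longrightarrow> pair_graph H \<Longrightarrow> reduced_graph H \<Longrightarrow> graph_rank H = r \<Longrightarrow>
      card (pverts H) \<le> max_order r"
  shows "\<And>(r::nat) (G :: 'a pair_pre_digraph).
      2 \<le> r \<Longrightarrow> pair_graph G \<Longrightarrow> reduced_graph G \<Longrightarrow> graph_rank G = r \<Longrightarrow>
      card (pverts G) \<le> max_order r"
proof -
  fix r :: nat and G :: "'a pair_pre_digraph"
  assume "2 \<le> r" "pair_graph G" "reduced_graph G" "graph_rank G = r"
  then show "card (pverts G) \<le> max_order r"
  proof (induction r arbitrary: G rule: less_induct)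
    case (less r)
    note fG = pair_graph_facts[OF less.prems(2)]
    have red: "(\<forall>u\<in>pverts G. \<exists>v\<in>pverts G. (u, v) \<in> parcs G) \<and>
      (\<forall>u\<in>pverts G. \<forall>v\<in>pverts G. u \<noteq> v \<longrightarrow> (\<exists>w\<in>pverts G. ((u, w) \<in> parcs G) \<noteq> ((v, w) \<in> parcs G)))"
      using less.prems(3) fG(3) by (subst (asm) reduced_graph_iff) auto
    show ?case
    proof (cases "r \<le> 46")
      case True
      obtain H :: "nat pair_pre_digraph" where H: "pair_graph H" "reduced_graph H"
        "graph_rank H = graph_rank G" "card (pverts H) = card (pverts G)"
        using reduced_graph_to_nat[OF less.prems(2,3)] by blast
      then show ?thesis using assms[OF less.prems(1) True H(1,2)] less.prems(4) by simp
    next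
      case False
      show ?thesis
      proof (rule ccontr)
        assume gt: "\<not> card (pverts G) \<le> max_order r"
        interpret minimal_counterexample "pverts G" "\<lambda>u v. (u, v) \<in> parcs G" r
          "\<lambda>u v. of_bool ((u, v) \<in> parcs G)" "\<lambda>T. set_matrix_rank T (\<lambda>u v. of_bool ((u, v) \<in> parcs G))"
        proof unfold_locales
          show "(u, v) \<in> parcs G \<longleftrightarrow> (v, u) \<in> parcs G" for u v by (rule fG(4))
        next
          \<comment> \<open>Minimality comes from the induction hypothesis for the induced subgraph
            on \<open>T\<close>, which keeps the vertex type.\<close>
          fix T
          let ?rk = "set_matrix_rank T (\<lambda>u v. of_bool ((u, v) \<in> parcs G))"
          let ?H = "\<lparr>pverts = T, parcs = {(u, v). u \<in> T \<and> v \<in> T \<and> (u, v) \<in> parcs G}\<rparr>"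
          assume T: "T \<subseteq> pverts G" "2 \<le> ?rk" "?rk < r" "\<And>u. u \<in> T \<Longrightarrow> \<exists>v\<in>T. (u, v) \<in> parcs G"
            "\<And>u v. u \<in> T \<Longrightarrow> v \<in> T \<Longrightarrow> u \<noteq> v \<Longrightarrow> \<exists>w\<in>T. ((u, w) \<in> parcs G) \<noteq> ((v, w) \<in> parcs G)"
          have "finite T" using T(1) fG(1) by (rule finite_subset)
          then have pg: "pair_graph ?H"
          proof (rule pair_graphI)
            fix u v assume "(u, v) \<in> {(u, v). u \<in> T \<and> v \<in> T \<and> (u, v) \<in> parcs G}"
            then show "u \<in> T \<and> v \<in> T \<and> u \<noteq> v \<and> (v, u) \<in> {(u, v). u \<in> T \<and> v \<in> T \<and> (u, v) \<in> parcs G}"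
              using fG(4)[of u v] fG(5)[of u] by auto
          qed
          have rg: "reduced_graph ?H"
            using T(4,5) by (subst reduced_graph_iff) simp_all
          have "graph_rank ?H = ?rk"
            unfolding graph_rank_of_bool by simp (rule set_matrix_rank_cong, simp)
          then show "card T \<le> max_order ?rk" using less.IH[OF T(3,2) pg rg] by simp
        qed (use fG(1,5) red less.prems gt False in \<open>simp_all add: graph_rank_of_bool\<close>)
        show False by (rule no_counterexample)
      qed
    qed
  qed
qed

end
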